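(* Let $R$ be a commutative associative ring with unit, let $X$ be a finite set equipped with a linear order, and let $G=\langle X,E\rangle$ be an undirected graph without loops with vertex set $X$ and edge set $E$. Then a linear basis (over $R$) of the partially commutative Lie algebra $\mathcal{L}(G)=\mathcal{L}_R(G)$ consists of (the images in $\mathcal{L}(G)$ of) all non-associative Lyndon--Shirshov words in $X$ that do not contain subwords $[u]$ of the form $[u]=([\tilde u],b)$ with $b\in X$ such that the greatest letter of $u$ has exactly one occurrence in $u$, $b$ is the second largest letter of $u$, and $G$ contains all edges of the form $\{b,x\}$, where $x$ is a letter of $\tilde u$.
   Context: Lie products are written $(x,y)$. $\mathrm{Lie}_R(X)$ is the free Lie $R$-algebra with set of generators $X$. The partially commutative Lie algebra $\mathcal{L}_R(G)$ is the Lie $R$-algebra with set of generators $X$ and defining relations $(x_i,x_j)=0$ for $\{x_i,x_j\}\in E$, i.e. the quotient of $\mathrm{Lie}_R(X)$ by the ideal generated by the elements $(x_i,x_j)$ with $\{x_i,x_j\}\in E$. $X^*$ is the set of all associative words in $X$, including the empty word $1$. The lexicographic order $<$ on $X^*$ extends the given linear order on $X$: $u<1$ for every non-empty word $u$; and inductively, for $u=x_iu'$, $v=x_jv'$ with $x_i,x_j\in X$, $u<v$ if either $x_i<x_j$, or $x_i=x_j$ and $u'<v'$. (Thus a proper prefix of a word is greater than the word.) An associative (non-empty) word $u$ is an associative Lyndon--Shirshov word if for all non-empty words $v,w$ with $u=vw$ one has $wv<u$. For a non-associative (bracketed, non-empty) word $[u]$, $u$ denotes the associative word obtained by removing all brackets.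 A non-associative word $[u]$ is a (non-associative) Lyndon--Shirshov word if: (i) $u$ is an associative Lyndon--Shirshov word; (ii) if $[u]=([u_1],[u_2])$ then $[u_1]$ and $[u_2]$ are non-associative Lyndon--Shirshov words and $u_1>u_2$; (iii) if moreover $[u_1]=([u_{11}],[u_{12}])$ then $u_2\geqslant u_{12}$. In particular letters are Lyndon--Shirshov words. Each associative Lyndon--Shirshov word $u$ has a unique bracketing $[u]$ that is a non-associative Lyndon--Shirshov word. Non-associative words are evaluated in Lie algebras via the Lie product. For Lyndon--Shirshov words $[u],[v]$, $[u]$ is called a subword of $[v]$ if the associative word $u$ is a (contiguous) subword of $v$, i.e. $v=aub$ for some $a,b\in X^*$. *)

theory Defs
  imports "HOL-Algebra.Module" "HOL-Algebra.QuotRing" "HOL-Library.Sublist"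
begin

section \<open>Non-associative algebras over a commutative ring\<close>

text \<open>
  A (possibly non-associative, non-unital) algebra is represented by a record of type
  \<open>module\<close>: its product, for instance a Lie product, is the component \<open>mult\<close>, written
  \<open>\<otimes>\<close>. The component \<open>one\<close>, which that record type inherits from \<open>ring\<close>, has no meaning here.
\<close>

locale nonassoc_algebra = module R A
  for R :: "('r, 'm) ring_scheme" (structure) and A :: "('r, 'a) module" (structure) +
  assumes prod_closed:
      "\<lbrakk>x \<in> carrier A; y \<in> carrier A\<rbrakk> \<Longrightarrow> x \<otimes>\<^bsub>A\<^esub> y \<in> carrier A"
    and prod_l_distr:
      "\<lbrakk>x \<in> carrier A; y \<in> carrier A; z \<in> carrier A\<rbrakk>
        \<Longrightarrow> (x \<oplus>\<^bsub>A\<^esub> y) \<otimes>\<^bsub>A\<^esub> z = x \<otimes>\<^bsub>A\<^esub> z \<oplus>\<^bsub>A\<^esub> y \<otimes>\<^bsub>A\<^esub> z"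
    and prod_r_distr:
      "\<lbrakk>x \<in> carrier A; y \<in> carrier A; z \<in> carrier A\<rbrakk>
        \<Longrightarrow> x \<otimes>\<^bsub>A\<^esub> (y \<oplus>\<^bsub>A\<^esub> z) = x \<otimes>\<^bsub>A\<^esub> y \<oplus>\<^bsub>A\<^esub> x \<otimes>\<^bsub>A\<^esub> z"
    and prod_smult_l:
      "\<lbrakk>r \<in> carrier R; x \<in> carrier A; y \<in> carrier A\<rbrakk>
        \<Longrightarrow> (r \<odot>\<^bsub>A\<^esub> x) \<otimes>\<^bsub>A\<^esub> y = r \<odot>\<^bsub>A\<^esub> (x \<otimes>\<^bsub>A\<^esub> y)"
    and prod_smult_r:
      "\<lbrakk>r \<in> carrier R; x \<in> carrier A; y \<in> carrier A\<rbrakk>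
        \<Longrightarrow> x \<otimes>\<^bsub>A\<^esub> (r \<odot>\<^bsub>A\<^esub> y) = r \<odot>\<^bsub>A\<^esub> (x \<otimes>\<^bsub>A\<^esub> y)"

definition jacobian :: "('a, 'm) ring_scheme \<Rightarrow> 'a \<Rightarrow> 'a \<Rightarrow> 'a \<Rightarrow> 'a" where
  "jacobian A x y z =
     ((x \<otimes>\<^bsub>A\<^esub> y) \<otimes>\<^bsub>A\<^esub> z) \<oplus>\<^bsub>A\<^esub> (((y \<otimes>\<^bsub>A\<^esub> z) \<otimes>\<^bsub>A\<^esub> x) \<oplus>\<^bsub>A\<^esub> ((z \<otimes>\<^bsub>A\<^esub> x) \<otimes>\<^bsub>A\<^esub> y))"

locale lie_algebra = nonassoc_algebra R L
  for R :: "('r, 'm) ring_scheme" (structure) and L :: "('r, 'a) module" (structure) +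
  assumes alternating: "x \<in> carrier L \<Longrightarrow> x \<otimes>\<^bsub>L\<^esub> x = \<zero>\<^bsub>L\<^esub>"
    and jacobi: "\<lbrakk>x \<in> carrier L; y \<in> carrier L; z \<in> carrier L\<rbrakk> \<Longrightarrow> jacobian L x y z = \<zero>\<^bsub>L\<^esub>"

definition algebra_ideal :: "('r, 'm) ring_scheme \<Rightarrow> ('r, 'a) module \<Rightarrow> 'a set \<Rightarrow> bool" where
  "algebra_ideal R A I \<longleftrightarrow>
     submodule I R A \<and> (\<forall>a\<in>carrier A. \<forall>i\<in>I. a \<otimes>\<^bsub>A\<^esub> i \<in> I \<and> i \<otimes>\<^bsub>A\<^esub> a \<in> I)"

definition ideal_gen :: "('r, 'm) ring_scheme \<Rightarrow> ('r, 'a) module \<Rightarrow> 'a set \<Rightarrow> 'a set" where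
  "ideal_gen R A S = \<Inter>{I. algebra_ideal R A I \<and> S \<subseteq> I}"

definition quot_algebra :: "('r, 'a) module \<Rightarrow> 'a set \<Rightarrow> ('r, 'a set) module" where
  "quot_algebra A I =
     \<lparr>carrier = a_rcosets\<^bsub>A\<^esub> I,
      monoid.mult = rcoset_mult A I,
      one = I +>\<^bsub>A\<^esub> \<one>\<^bsub>A\<^esub>,
      ring.zero = I,
      add = set_add A,
      smult = (\<lambda>r C. \<Union>c\<in>C. I +>\<^bsub>A\<^esub> (r \<odot>\<^bsub>A\<^esub> c))\<rparr>"

text \<open>
  Bases are stated for indexed families, so that distinct indices have to give linearly
  independent (hence, over a nonzero ring, distinct) elements.
\<close>

definition lin_basis :: "('r, 'm) ring_scheme \<Rightarrow> ('r, 'a) module \<Rightarrow> 'i set \<Rightarrow> ('i \<Rightarrow> 'a) \<Rightarrow> bool" where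
  "lin_basis R M B v \<longleftrightarrow>
     v \<in> B \<rightarrow> carrier M \<and>
     (\<forall>F c. finite F \<and> F \<subseteq> B \<and> c \<in> F \<rightarrow> carrier R \<and>
            (\<Oplus>\<^bsub>M\<^esub>i\<in>F. c i \<odot>\<^bsub>M\<^esub> v i) = \<zero>\<^bsub>M\<^esub>
        \<longrightarrow> (\<forall>i\<in>F. c i = \<zero>\<^bsub>R\<^esub>)) \<and>
     (\<forall>m\<in>carrier M. \<exists>F c. finite F \<and> F \<subseteq> B \<and> c \<in> F \<rightarrow> carrier R \<and>
            m = (\<Oplus>\<^bsub>M\<^esub>i\<in>F. c i \<odot>\<^bsub>M\<^esub> v i))"


section \<open>Words\<close>

datatype 'x naword = Letter 'x | Br "'x naword" "'x naword"

primrec word :: "'x naword \<Rightarrow> 'x list" where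
  "word (Letter x) = [x]"
| "word (Br s t) = word s @ word t"

primrec lie_eval :: "('a, 'm) ring_scheme \<Rightarrow> ('x \<Rightarrow> 'a) \<Rightarrow> 'x naword \<Rightarrow> 'a" where
  "lie_eval L g (Letter x) = g x"
| "lie_eval L g (Br s t) = lie_eval L g s \<otimes>\<^bsub>L\<^esub> lie_eval L g t"


section \<open>Free and partially commutative Lie algebras\<close>

text \<open>
  The free non-associative algebra: finitely supported functions on the non-associative words
  in \<open>V\<close>, read as formal linear combinations. Every word of length at least two factors uniquely,
  so the convolution product has a single summand at each word.
\<close>

definition free_nonassoc :: "('r, 'm) ring_scheme \<Rightarrow> 'x set \<Rightarrow> ('r, 'x naword \<Rightarrow> 'r) module" where
  "free_nonassoc R V =
     \<lparr>carrier = {f. (\<forall>t. f t \<in> carrier R) \<and> finite {t. f t \<noteq> \<zero>\<^bsub>R\<^esub>}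
                    \<and> (\<forall>t. f t \<noteq> \<zero>\<^bsub>R\<^esub> \<longrightarrow> set (word t) \<subseteq> V)},
      monoid.mult = (\<lambda>f g t. case t of Letter x \<Rightarrow> \<zero>\<^bsub>R\<^esub> | Br s s' \<Rightarrow> f s \<otimes>\<^bsub>R\<^esub> g s'),
      one = (\<lambda>t. \<zero>\<^bsub>R\<^esub>),
      ring.zero = (\<lambda>t. \<zero>\<^bsub>R\<^esub>),
      add = (\<lambda>f g t. f t \<oplus>\<^bsub>R\<^esub> g t),
      smult = (\<lambda>r f t. r \<otimes>\<^bsub>R\<^esub> f t)\<rparr>"

definition nonassoc_gen :: "('r, 'm) ring_scheme \<Rightarrow> 'x \<Rightarrow> 'x naword \<Rightarrow> 'r" where
  "nonassoc_gen R x = (\<lambda>t. if t = Letter x then \<one>\<^bsub>R\<^esub> else \<zero>\<^bsub>R\<^esub>)"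

definition lie_identities :: "('a, 'm) ring_scheme \<Rightarrow> 'a set" where
  "lie_identities A =
     {x \<otimes>\<^bsub>A\<^esub> x | x. x \<in> carrier A} \<union>
     {jacobian A x y z | x y z. x \<in> carrier A \<and> y \<in> carrier A \<and> z \<in> carrier A}"

definition free_lie_ideal :: "('r, 'm) ring_scheme \<Rightarrow> 'x set \<Rightarrow> ('x naword \<Rightarrow> 'r) set" where
  "free_lie_ideal R V = ideal_gen R (free_nonassoc R V) (lie_identities (free_nonassoc R V))"

definition free_lie :: "('r, 'm) ring_scheme \<Rightarrow> 'x set \<Rightarrow> ('r, ('x naword \<Rightarrow> 'r) set) module" where
  "free_lie R V = quot_algebra (free_nonassoc R V) (free_lie_ideal R V)"

definition free_lie_gen :: "('r, 'm) ring_scheme \<Rightarrow> 'x set \<Rightarrow> 'x \<Rightarrow> ('x naword \<Rightarrow> 'r) set" where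
  "free_lie_gen R V x = free_lie_ideal R V +>\<^bsub>free_nonassoc R V\<^esub> nonassoc_gen R x"

definition pc_lie_ideal ::
    "('r, 'm) ring_scheme \<Rightarrow> 'x set \<Rightarrow> 'x set set \<Rightarrow> ('x naword \<Rightarrow> 'r) set set" where
  "pc_lie_ideal R V E = ideal_gen R (free_lie R V)
     {free_lie_gen R V x \<otimes>\<^bsub>free_lie R V\<^esub> free_lie_gen R V y | x y. {x, y} \<in> E}"

definition pc_lie ::
    "('r, 'm) ring_scheme \<Rightarrow> 'x set \<Rightarrow> 'x set set \<Rightarrow> ('r, ('x naword \<Rightarrow> 'r) set set) module" where
  "pc_lie R V E = quot_algebra (free_lie R V) (pc_lie_ideal R V E)"

definition pc_lie_gen ::
    "('r, 'm) ring_scheme \<Rightarrow> 'x set \<Rightarrow> 'x set set \<Rightarrow> 'x \<Rightarrow> ('x naword \<Rightarrow> 'r) set set" where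
  "pc_lie_gen R V E x = pc_lie_ideal R V E +>\<^bsub>free_lie R V\<^esub> free_lie_gen R V x"


text \<open>
  The coset operations of \<open>quot_algebra\<close> are the expected ones for algebra ideals, so that
  \<open>free_lie\<close> and \<open>pc_lie\<close> are indeed Lie algebras over \<open>R\<close>.
\<close>

lemma (in nonassoc_algebra) algebra_ideal_ideal_gen:
  assumes "S \<subseteq> carrier A"
  shows "algebra_ideal R A (ideal_gen R A S)" and "S \<subseteq> ideal_gen R A S"
    and "ideal_gen R A S \<subseteq> carrier A"
proof -
  have c: "algebra_ideal R A (carrier A)"
    unfolding algebra_ideal_def using carrier_is_submodule prod_closed by blast
  show "S \<subseteq> ideal_gen R A S" unfolding ideal_gen_def by blast
  show sub: "ideal_gen R A S \<subseteq> carrier A" unfolding ideal_gen_def using c assms by blast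
  have "submodule (ideal_gen R A S) R A"
  proof (rule submoduleI[OF sub])
    show "\<zero>\<^bsub>A\<^esub> \<in> ideal_gen R A S"
      unfolding ideal_gen_def algebra_ideal_def
      using subgroup.one_closed[of _ "add_monoid A"] by (auto dest!: submodule.axioms(1))
  qed (auto simp: ideal_gen_def algebra_ideal_def submoduleE)
  then show "algebra_ideal R A (ideal_gen R A S)"
    unfolding algebra_ideal_def by (auto simp: ideal_gen_def algebra_ideal_def)
qed

lemma (in nonassoc_algebra) quot_algebra:
  assumes I: "algebra_ideal R A I"
  shows "nonassoc_algebra R (quot_algebra A I)"
    and "carrier (quot_algebra A I) = (\<lambda>x. I +>\<^bsub>A\<^esub> x) ` carrier A"
    and "x \<in> carrier A \<Longrightarrow> y \<in> carrier A
      \<Longrightarrow> (I +>\<^bsub>A\<^esub> x) \<oplus>\<^bsub>quot_algebra A I\<^esub> (I +>\<^bsub>A\<^esub> y) = I +>\<^bsub>A\<^esub> (x \<oplus>\<^bsub>A\<^esub> y)"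
    and "x \<in> carrier A \<Longrightarrow> y \<in> carrier A
      \<Longrightarrow> (I +>\<^bsub>A\<^esub> x) \<otimes>\<^bsub>quot_algebra A I\<^esub> (I +>\<^bsub>A\<^esub> y) = I +>\<^bsub>A\<^esub> (x \<otimes>\<^bsub>A\<^esub> y)"
    and "r \<in> carrier R \<Longrightarrow> x \<in> carrier A
      \<Longrightarrow> r \<odot>\<^bsub>quot_algebra A I\<^esub> (I +>\<^bsub>A\<^esub> x) = I +>\<^bsub>A\<^esub> (r \<odot>\<^bsub>A\<^esub> x)"
    and "\<zero>\<^bsub>quot_algebra A I\<^esub> = I"
    and "x \<in> carrier A \<Longrightarrow> I +>\<^bsub>A\<^esub> x = I \<longleftrightarrow> x \<in> I"
proof -
  let ?Q = "quot_algebra A I"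
  have sm: "submodule I R A"
    and idl: "\<And>a i. a \<in> carrier A \<Longrightarrow> i \<in> I \<Longrightarrow> a \<otimes>\<^bsub>A\<^esub> i \<in> I"
    and idr: "\<And>a i. a \<in> carrier A \<Longrightarrow> i \<in> I \<Longrightarrow> i \<otimes>\<^bsub>A\<^esub> a \<in> I"
    using I unfolding algebra_ideal_def by auto
  note smE = submoduleE[OF sm]
  have Ic: "\<And>i. i \<in> I \<Longrightarrow> i \<in> carrier A" using smE(1) by blast
  interpret I: abelian_subgroup I A
    by (rule abelian_subgroupI3)
      (auto simp: additive_subgroup_def submodule.axioms(1)[OF sm] M.abelian_group_axioms)
  have eqI: "I +>\<^bsub>A\<^esub> x = I +>\<^bsub>A\<^esub> y" if "x = i \<oplus>\<^bsub>A\<^esub> y" "i \<in> I" "y \<in> carrier A" for x y i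
  proof -
    have "x \<in> I +>\<^bsub>A\<^esub> y" using that M.a_rcosI[OF that(2) smE(1) that(3)] by simp
    then show ?thesis using M.a_repr_independence[OF _ that(3) I.a_subgroup] by simp
  qed
  have mem: "\<exists>i\<in>I. a = i \<oplus>\<^bsub>A\<^esub> x" if "a \<in> I +>\<^bsub>A\<^esub> x" for a x
    using that unfolding a_r_coset_def' by auto
  have self: "x \<in> I +>\<^bsub>A\<^esub> x" if "x \<in> carrier A" for x by (rule I.a_rcos_self[OF that])
  have ne: "I +>\<^bsub>A\<^esub> x \<noteq> {}" if "x \<in> carrier A" for x using self[OF that] by blast
  show car: "carrier ?Q = (\<lambda>x. I +>\<^bsub>A\<^esub> x) ` carrier A"
    unfolding quot_algebra_def A_RCOSETS_def' by auto
  have add: "(I +>\<^bsub>A\<^esub> x) \<oplus>\<^bsub>?Q\<^esub> (I +>\<^bsub>A\<^esub> y) = I +>\<^bsub>A\<^esub> (x \<oplus>\<^bsub>A\<^esub> y)"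
    if "x \<in> carrier A" "y \<in> carrier A" for x y
    using I.a_rcos_sum[OF that] unfolding quot_algebra_def by simp
  have mult: "(I +>\<^bsub>A\<^esub> x) \<otimes>\<^bsub>?Q\<^esub> (I +>\<^bsub>A\<^esub> y) = I +>\<^bsub>A\<^esub> (x \<otimes>\<^bsub>A\<^esub> y)"
    if xy: "x \<in> carrier A" "y \<in> carrier A" for x y
  proof -
    have "I +>\<^bsub>A\<^esub> (a \<otimes>\<^bsub>A\<^esub> b) = I +>\<^bsub>A\<^esub> (x \<otimes>\<^bsub>A\<^esub> y)" if ab: "a \<in> I +>\<^bsub>A\<^esub> x" "b \<in> I +>\<^bsub>A\<^esub> y" for a b
    proof -
      obtain i j where ij: "i \<in> I" "j \<in> I" "a = i \<oplus>\<^bsub>A\<^esub> x" "b = j \<oplus>\<^bsub>A\<^esub> y"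
        using mem[OF ab(1)] mem[OF ab(2)] by auto
      note c = Ic[OF ij(1)] Ic[OF ij(2)] xy
      have "a \<otimes>\<^bsub>A\<^esub> b = (i \<otimes>\<^bsub>A\<^esub> (j \<oplus>\<^bsub>A\<^esub> y) \<oplus>\<^bsub>A\<^esub> x \<otimes>\<^bsub>A\<^esub> j) \<oplus>\<^bsub>A\<^esub> x \<otimes>\<^bsub>A\<^esub> y"
        using c unfolding ij by (simp add: prod_l_distr prod_r_distr prod_closed M.a_ac)
      moreover have "i \<otimes>\<^bsub>A\<^esub> (j \<oplus>\<^bsub>A\<^esub> y) \<oplus>\<^bsub>A\<^esub> x \<otimes>\<^bsub>A\<^esub> j \<in> I"
        using smE(5)[OF idr[of "j \<oplus>\<^bsub>A\<^esub> y" i] idl[of x j]] c ij by simp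
      ultimately show ?thesis using eqI prod_closed[OF xy] by simp
    qed
    then have "rcoset_mult A I (I +>\<^bsub>A\<^esub> x) (I +>\<^bsub>A\<^esub> y)
        = (\<Union>a\<in>I +>\<^bsub>A\<^esub> x. \<Union>b\<in>I +>\<^bsub>A\<^esub> y. I +>\<^bsub>A\<^esub> (x \<otimes>\<^bsub>A\<^esub> y))"
      unfolding rcoset_mult_def by (intro SUP_cong refl)
    then show ?thesis using ne[OF xy(1)] ne[OF xy(2)] by (simp add: quot_algebra_def)
  qed
  have smult: "r \<odot>\<^bsub>?Q\<^esub> (I +>\<^bsub>A\<^esub> x) = I +>\<^bsub>A\<^esub> (r \<odot>\<^bsub>A\<^esub> x)"
    if rx: "r \<in> carrier R" "x \<in> carrier A" for r x
  proof -
    have "I +>\<^bsub>A\<^esub> (r \<odot>\<^bsub>A\<^esub> a) = I +>\<^bsub>A\<^esub> (r \<odot>\<^bsub>A\<^esub> x)" if a: "a \<in> I +>\<^bsub>A\<^esub> x" for a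
    proof -
      obtain i where i: "i \<in> I" "a = i \<oplus>\<^bsub>A\<^esub> x" using mem[OF a] by auto
      have "r \<odot>\<^bsub>A\<^esub> a = r \<odot>\<^bsub>A\<^esub> i \<oplus>\<^bsub>A\<^esub> r \<odot>\<^bsub>A\<^esub> x"
        using rx Ic[OF i(1)] unfolding i by (simp add: smult_r_distr)
      then show ?thesis using eqI smE(4)[OF rx(1) i(1)] smult_closed[OF rx] by simp
    qed
    then have "(\<Union>a\<in>I +>\<^bsub>A\<^esub> x. I +>\<^bsub>A\<^esub> (r \<odot>\<^bsub>A\<^esub> a)) = (\<Union>a\<in>I +>\<^bsub>A\<^esub> x. I +>\<^bsub>A\<^esub> (r \<odot>\<^bsub>A\<^esub> x))"
      by (intro SUP_cong refl)
    then show ?thesis using ne[OF rx(2)] by (simp add: quot_algebra_def)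
  qed
  have zero: "\<zero>\<^bsub>?Q\<^esub> = I" unfolding quot_algebra_def by simp
  have zero': "I +>\<^bsub>A\<^esub> \<zero>\<^bsub>A\<^esub> = I" by (simp add: smE(1) M.a_coset_add_zero)
  have mem_iff: "I +>\<^bsub>A\<^esub> x = I \<longleftrightarrow> x \<in> I" if "x \<in> carrier A" for x
    using self[OF that] I.a_rcos_const by auto
  have "abelian_group ?Q"
  proof (rule abelian_groupI)
    fix C assume "C \<in> carrier ?Q"
    then obtain x where x: "x \<in> carrier A" "C = I +>\<^bsub>A\<^esub> x" unfolding car by auto
    have "(I +>\<^bsub>A\<^esub> (\<ominus>\<^bsub>A\<^esub> x)) \<oplus>\<^bsub>?Q\<^esub> C = \<zero>\<^bsub>?Q\<^esub>"
      using x add zero zero' by (simp add: M.l_neg)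
    moreover have "I +>\<^bsub>A\<^esub> (\<ominus>\<^bsub>A\<^esub> x) \<in> carrier ?Q" using x car by auto
    ultimately show "\<exists>D\<in>carrier ?Q. D \<oplus>\<^bsub>?Q\<^esub> C = \<zero>\<^bsub>?Q\<^esub>" by blast
    have "\<zero>\<^bsub>?Q\<^esub> = I +>\<^bsub>A\<^esub> \<zero>\<^bsub>A\<^esub>" using zero zero' by simp
    then show "\<zero>\<^bsub>?Q\<^esub> \<oplus>\<^bsub>?Q\<^esub> C = C" using x add by simp
  next
    show "\<zero>\<^bsub>?Q\<^esub> \<in> carrier ?Q" using zero zero' car by (metis M.zero_closed imageI)
  qed (auto del: equalityI simp: car add M.a_ac)
  then have "module R ?Q"
    by (intro moduleI)
      (auto del: equalityI simp: car add smult smult_l_distr smult_r_distr smult_assoc1 R.is_cring)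
  then show "nonassoc_algebra R ?Q"
    by (intro nonassoc_algebra.intro nonassoc_algebra_axioms.intro)
      (auto del: equalityI simp: car add smult mult prod_closed prod_l_distr prod_r_distr prod_smult_l prod_smult_r)
  show "x \<in> carrier A \<Longrightarrow> y \<in> carrier A \<Longrightarrow> (I +>\<^bsub>A\<^esub> x) \<oplus>\<^bsub>?Q\<^esub> (I +>\<^bsub>A\<^esub> y) = I +>\<^bsub>A\<^esub> (x \<oplus>\<^bsub>A\<^esub> y)"
    "x \<in> carrier A \<Longrightarrow> y \<in> carrier A \<Longrightarrow> (I +>\<^bsub>A\<^esub> x) \<otimes>\<^bsub>?Q\<^esub> (I +>\<^bsub>A\<^esub> y) = I +>\<^bsub>A\<^esub> (x \<otimes>\<^bsub>A\<^esub> y)"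
    "r \<in> carrier R \<Longrightarrow> x \<in> carrier A \<Longrightarrow> r \<odot>\<^bsub>?Q\<^esub> (I +>\<^bsub>A\<^esub> x) = I +>\<^bsub>A\<^esub> (r \<odot>\<^bsub>A\<^esub> x)"
    "\<zero>\<^bsub>?Q\<^esub> = I" "x \<in> carrier A \<Longrightarrow> I +>\<^bsub>A\<^esub> x = I \<longleftrightarrow> x \<in> I"
    using add mult smult zero mem_iff by auto
qed

lemma (in nonassoc_algebra) jacobian_quot:
  assumes "algebra_ideal R A I" "x \<in> carrier A" "y \<in> carrier A" "z \<in> carrier A"
  shows "jacobian (quot_algebra A I) (I +>\<^bsub>A\<^esub> x) (I +>\<^bsub>A\<^esub> y) (I +>\<^bsub>A\<^esub> z) = I +>\<^bsub>A\<^esub> jacobian A x y z"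
    and "jacobian A x y z \<in> carrier A"
  using assms(2-4) by (simp_all add: jacobian_def quot_algebra(3,4)[OF assms(1)] prod_closed)

lemma (in lie_algebra) lie_algebra_quot:
  assumes I: "algebra_ideal R L I"
  shows "lie_algebra R (quot_algebra L I)"
proof -
  have "I +>\<^bsub>L\<^esub> \<zero>\<^bsub>L\<^esub> = I"
    using quot_algebra(7)[OF I] submoduleE[of I] subgroup.one_closed[of I "add_monoid L"] I
    by (auto simp: algebra_ideal_def dest: submodule.axioms(1))
  note zero = this
  show ?thesis
    by (intro lie_algebra.intro lie_algebra_axioms.intro quot_algebra(1)[OF I])
      (auto del: equalityI simp: zero quot_algebra[OF I] jacobian_quot[OF I] alternating jacobi)
qed

lemma nonassoc_algebra_free_nonassoc:
  assumes "cring R"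
  shows "nonassoc_algebra R (free_nonassoc R V)"
proof -
  interpret R: cring R by fact
  let ?A = "free_nonassoc R V"
  have add_c: "f \<oplus>\<^bsub>?A\<^esub> g \<in> carrier ?A" if "f \<in> carrier ?A" "g \<in> carrier ?A" for f g
  proof -
    have "{t. f t \<oplus>\<^bsub>R\<^esub> g t \<noteq> \<zero>\<^bsub>R\<^esub>} \<subseteq> {t. f t \<noteq> \<zero>\<^bsub>R\<^esub>} \<union> {t. g t \<noteq> \<zero>\<^bsub>R\<^esub>}" by auto
    then have "finite {t. f t \<oplus>\<^bsub>R\<^esub> g t \<noteq> \<zero>\<^bsub>R\<^esub>}"
      using that by (auto simp: free_nonassoc_def intro: finite_subset)
    moreover have "set (word t) \<subseteq> V" if "f t \<oplus>\<^bsub>R\<^esub> g t \<noteq> \<zero>\<^bsub>R\<^esub>" for t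
    proof -
      have "f t \<noteq> \<zero>\<^bsub>R\<^esub> \<or> g t \<noteq> \<zero>\<^bsub>R\<^esub>" using that by auto
      then show ?thesis
        using \<open>f \<in> carrier ?A\<close> \<open>g \<in> carrier ?A\<close> by (auto simp: free_nonassoc_def)
    qed
    ultimately show ?thesis using that by (simp add: free_nonassoc_def)
  qed
  have smult_c: "r \<odot>\<^bsub>?A\<^esub> f \<in> carrier ?A" if "r \<in> carrier R" "f \<in> carrier ?A" for r f
  proof -
    have "{t. r \<otimes>\<^bsub>R\<^esub> f t \<noteq> \<zero>\<^bsub>R\<^esub>} \<subseteq> {t. f t \<noteq> \<zero>\<^bsub>R\<^esub>}" using that by auto
    then show ?thesis using that by (auto simp: free_nonassoc_def intro: finite_subset)
  qed
  have mult_c: "f \<otimes>\<^bsub>?A\<^esub> g \<in> carrier ?A" if "f \<in> carrier ?A" "g \<in> carrier ?A" for f g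
  proof -
    have "{t. (f \<otimes>\<^bsub>?A\<^esub> g) t \<noteq> \<zero>\<^bsub>R\<^esub>}
        \<subseteq> (\<lambda>(s, t). Br s t) ` ({t. f t \<noteq> \<zero>\<^bsub>R\<^esub>} \<times> {t. g t \<noteq> \<zero>\<^bsub>R\<^esub>})"
    proof
      fix t assume "t \<in> {t. (f \<otimes>\<^bsub>?A\<^esub> g) t \<noteq> \<zero>\<^bsub>R\<^esub>}"
      then show "t \<in> (\<lambda>(s, t). Br s t) ` ({t. f t \<noteq> \<zero>\<^bsub>R\<^esub>} \<times> {t. g t \<noteq> \<zero>\<^bsub>R\<^esub>})"
        using that by (cases t) (auto simp: free_nonassoc_def)
    qed
    then have fin: "finite {t. (f \<otimes>\<^bsub>?A\<^esub> g) t \<noteq> \<zero>\<^bsub>R\<^esub>}"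
      using that by (auto simp: free_nonassoc_def intro: finite_subset)
    have "(f \<otimes>\<^bsub>?A\<^esub> g) t \<in> carrier R \<and> ((f \<otimes>\<^bsub>?A\<^esub> g) t \<noteq> \<zero>\<^bsub>R\<^esub> \<longrightarrow> set (word t) \<subseteq> V)" for t
    proof (cases t)
      case (Br u v)
      have "f u \<noteq> \<zero>\<^bsub>R\<^esub> \<and> g v \<noteq> \<zero>\<^bsub>R\<^esub>" if "f u \<otimes>\<^bsub>R\<^esub> g v \<noteq> \<zero>\<^bsub>R\<^esub>"
        using that \<open>f \<in> _\<close> \<open>g \<in> _\<close> by (auto simp: free_nonassoc_def)
      then show ?thesis using Br that by (auto simp: free_nonassoc_def)
    qed (simp add: free_nonassoc_def)
    then show ?thesis using fin by (simp add: free_nonassoc_def)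
  qed
  have val: "f t \<in> carrier R" if "f \<in> carrier ?A" for f t
    using that by (simp add: free_nonassoc_def)
  have ops: "(f \<oplus>\<^bsub>?A\<^esub> g) t = f t \<oplus>\<^bsub>R\<^esub> g t" "(r \<odot>\<^bsub>?A\<^esub> f) t = r \<otimes>\<^bsub>R\<^esub> f t" "\<zero>\<^bsub>?A\<^esub> t = \<zero>\<^bsub>R\<^esub>"
    "(f \<otimes>\<^bsub>?A\<^esub> g) t = (case t of Letter x \<Rightarrow> \<zero>\<^bsub>R\<^esub> | Br u v \<Rightarrow> f u \<otimes>\<^bsub>R\<^esub> g v)" for f g r t
    by (simp_all add: free_nonassoc_def)
  have zero_c: "\<zero>\<^bsub>?A\<^esub> \<in> carrier ?A" by (simp add: free_nonassoc_def)
  have "abelian_group ?A"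
  proof (rule abelian_groupI)
    fix f assume f: "f \<in> carrier ?A"
    show "\<exists>g\<in>carrier ?A. g \<oplus>\<^bsub>?A\<^esub> f = \<zero>\<^bsub>?A\<^esub>"
    proof
      show "(\<ominus>\<^bsub>R\<^esub> \<one>\<^bsub>R\<^esub>) \<odot>\<^bsub>?A\<^esub> f \<in> carrier ?A" using smult_c f by simp
      show "((\<ominus>\<^bsub>R\<^esub> \<one>\<^bsub>R\<^esub>) \<odot>\<^bsub>?A\<^esub> f) \<oplus>\<^bsub>?A\<^esub> f = \<zero>\<^bsub>?A\<^esub>"
        by (rule ext) (simp add: ops val[OF f] R.l_minus R.l_neg)
    qed
  qed (simp_all add: add_c zero_c fun_eq_iff ops val R.a_ac)
  then have "module R ?A"
    by (rule moduleI[OF assms _ smult_c])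
      (simp_all add: fun_eq_iff ops val R.l_distr R.r_distr R.m_assoc)
  then show ?thesis
    by (intro nonassoc_algebra.intro nonassoc_algebra_axioms.intro mult_c)
      (simp_all add: fun_eq_iff ops val R.l_distr R.r_distr R.m_ac split: naword.split)
qed

lemma lie_algebra_free_lie:
  assumes "cring R"
  shows "lie_algebra R (free_lie R V)"
proof -
  interpret nonassoc_algebra R "free_nonassoc R V"
    by (rule nonassoc_algebra_free_nonassoc[OF assms])
  let ?A = "free_nonassoc R V"
  let ?I = "free_lie_ideal R V"
  have jc: "jacobian ?A x y z \<in> carrier ?A"
    if "x \<in> carrier ?A" "y \<in> carrier ?A" "z \<in> carrier ?A" for x y z
    using that by (simp add: jacobian_def prod_closed)
  have sub: "lie_identities ?A \<subseteq> carrier ?A"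
    using jc prod_closed unfolding lie_identities_def by blast
  have I: "algebra_ideal R ?A ?I" and S: "lie_identities ?A \<subseteq> ?I"
    using algebra_ideal_ideal_gen[OF sub] unfolding free_lie_ideal_def by auto
  note Q = quot_algebra[OF I]
  have alt: "x \<otimes>\<^bsub>?A\<^esub> x \<in> ?I" if "x \<in> carrier ?A" for x
    using S that unfolding lie_identities_def by blast
  have jac: "jacobian ?A x y z \<in> ?I"
    if "x \<in> carrier ?A" "y \<in> carrier ?A" "z \<in> carrier ?A" for x y z
    using S that unfolding lie_identities_def by blast
  show ?thesis unfolding free_lie_def
    by (intro lie_algebra.intro lie_algebra_axioms.intro Q(1))
      (auto del: equalityI simp: Q(2,4,6,7) jacobian_quot[OF I] prod_closed alt jac)
qed

lemma nonassoc_gen_closed: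
  assumes "cring R" "x \<in> V"
  shows "nonassoc_gen R x \<in> carrier (free_nonassoc R V)"
proof -
  interpret R: cring R by fact
  have "{t. nonassoc_gen R x t \<noteq> \<zero>\<^bsub>R\<^esub>} \<subseteq> {Letter x}" by (auto simp: nonassoc_gen_def)
  then show ?thesis using assms
    by (auto simp: free_nonassoc_def nonassoc_gen_def intro: finite_subset)
qed

lemma free_lie_gen_closed:
  assumes "cring R" "x \<in> V"
  shows "free_lie_gen R V x \<in> carrier (free_lie R V)"
  using nonassoc_gen_closed[OF assms]
  by (auto simp: free_lie_gen_def free_lie_def quot_algebra_def A_RCOSETS_def')

lemma lie_algebra_pc_lie:
  assumes "cring R" and "\<And>x y. {x, y} \<in> E \<Longrightarrow> x \<in> V \<and> y \<in> V"
  shows "lie_algebra R (pc_lie R V E)"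
proof -
  interpret lie_algebra R "free_lie R V" by (rule lie_algebra_free_lie[OF assms(1)])
  have "{free_lie_gen R V x \<otimes>\<^bsub>free_lie R V\<^esub> free_lie_gen R V y | x y. {x, y} \<in> E}
      \<subseteq> carrier (free_lie R V)"
    using assms(2) by (auto intro!: prod_closed free_lie_gen_closed[OF assms(1)])
  then show ?thesis unfolding pc_lie_def pc_lie_ideal_def
    by (intro lie_algebra_quot algebra_ideal_ideal_gen(1))
qed


section \<open>Lyndon--Shirshov words\<close>

text \<open>The empty word is the greatest word: a proper prefix of a word is greater than the word.\<close>

fun word_less :: "'x::linorder list \<Rightarrow> 'x list \<Rightarrow> bool" where
  "word_less [] v \<longleftrightarrow> False"
| "word_less (x # u) [] \<longleftrightarrow> True"
| "word_less (x # u) (y # v) \<longleftrightarrow> x < y \<or> x = y \<and> word_less u v"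

definition assoc_LS :: "'x::linorder list \<Rightarrow> bool" where
  "assoc_LS u \<longleftrightarrow>
     u \<noteq> [] \<and> (\<forall>v w. v \<noteq> [] \<and> w \<noteq> [] \<and> u = v @ w \<longrightarrow> word_less (w @ v) u)"

fun nonassoc_LS :: "'x::linorder naword \<Rightarrow> bool" where
  "nonassoc_LS (Letter x) \<longleftrightarrow> assoc_LS (word (Letter x))"
| "nonassoc_LS (Br s t) \<longleftrightarrow>
     assoc_LS (word (Br s t)) \<and>
     nonassoc_LS s \<and> nonassoc_LS t \<and> word_less (word t) (word s) \<and>
     (\<forall>s1 s2. s = Br s1 s2 \<longrightarrow> word t = word s2 \<or> word_less (word s2) (word t))"

definition greatest_letter :: "'x::linorder list \<Rightarrow> 'x \<Rightarrow> bool" where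
  "greatest_letter u a \<longleftrightarrow> a \<in> set u \<and> (\<forall>y\<in>set u. y \<le> a)"

definition second_letter :: "'x::linorder list \<Rightarrow> 'x \<Rightarrow> bool" where
  "second_letter u b \<longleftrightarrow>
     (\<exists>a. greatest_letter u a \<and> b \<in> set u \<and> b \<noteq> a \<and> (\<forall>y\<in>set u. y \<noteq> a \<longrightarrow> y \<le> b))"

definition forbidden :: "'x::linorder set set \<Rightarrow> 'x naword \<Rightarrow> bool" where
  "forbidden E t \<longleftrightarrow>
     nonassoc_LS t \<and>
     (\<exists>s b. t = Br s (Letter b) \<and>
        (\<exists>a. greatest_letter (word t) a \<and> count_list (word t) a = 1) \<and>
        second_letter (word t) b \<and>
        (\<forall>x\<in>set (word s). {b, x} \<in> E))"

definition pc_basis_words :: "'x::linorder set \<Rightarrow> 'x set set \<Rightarrow> 'x naword set" where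
  "pc_basis_words V E =
     {t. set (word t) \<subseteq> V \<and> nonassoc_LS t \<and>
         \<not> (\<exists>s. forbidden E s \<and> sublist (word s) (word t))}"

end

theory Submission
  imports Defs "HOL-Library.Multiset"
begin

text \<open>
  The forbidden words are exactly the words \<open>a x b\<close> in which \<open>b < a\<close>, every letter of \<open>x\<close> is smaller
  than \<open>b\<close>, and \<open>b\<close> is joined to every letter of \<open>a x\<close> (\<open>commuting_factor\<close>, \<open>pc_basis_words_iff\<close>):
  a word \<open>a x\<close> with \<open>a\<close> above all letters of \<open>x\<close> always has a Lyndon--Shirshov bracketing. These are
  also the words whose rewriting \<open>a x b \<rightarrow> b a x\<close> computes the lexicographically smallest
  representative of a trace, that is, of an element of the monoid in which joined letters commute.
  The basis words are thus the Lyndon--Shirshov words that are minimal in their trace.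

  Independence. Expanded in the free associative algebra, the bracketing of a Lyndon--Shirshov
  word \<open>u\<close> is \<open>u\<close> plus smaller words of the same length. Consider a linear relation between basis
  words, and let \<open>u\<close> be the largest one with a nonzero coefficient. A word occurring in the expansion
  of a basis word of the relation is at most \<open>u\<close>, while every word of the trace of \<open>u\<close> is at least
  \<open>u\<close>; so the functional that sums the coefficients over the trace of \<open>u\<close> reads off just the
  coefficient of \<open>u\<close>. That functional factors through the partially commutative Lie algebra. To
  see this without constructing an associative algebra, the free non-associative algebra is made to
  act on functions of words: letters act by prepending to the argument and brackets act as
  commutators. The elements annihilating all functions that are constant on traces form an ideal
  that contains the Lie identities and the defining relations
  (\<open>word_action_leading\<close>, \<open>annihilator_ideal\<close>, \<open>proj_eq_zero_annihilator\<close>).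

  Spanning. The span of the basis words is closed under the product. For basis words \<open>u > v\<close> the
  product \<open>(u, v)\<close> is a combination of basis words that are at most \<open>u v\<close> and have its length
  (\<open>prod_in_span\<close>). This is an induction in which \<open>u v\<close> decreases among the words of the same length.
  If \<open>u = (p, q)\<close> with \<open>v < q\<close>, then \<open>((p, q), v) = ((p, v), q) + (p, (q, v))\<close> leads to smaller words,
  except that \<open>u v\<close> may reappear with a shorter left factor. Otherwise \<open>(u, v)\<close> is a bracketed
  Lyndon--Shirshov word. It can only fail to be a basis word if a forbidden factor crosses the
  boundary, and then \<open>u\<close> is all of \<open>a x\<close> and \<open>v\<close> begins with \<open>b\<close>. If \<open>v = b\<close>, the product is zero;
  if \<open>v = (p, q)\<close>, the Leibniz rule moves \<open>u\<close> inside, and the leading word drops because \<open>u p\<close> again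
  contains \<open>a x b\<close>.
\<close>

section \<open>The order on words and Lyndon--Shirshov words\<close>

text \<open>
  The part of \<open>word_less\<close> that is decided at a position inside both words; unlike \<open>word_less\<close>, it
  survives extending either word on the right. The two differ only when one word is a prefix of the
  other.
\<close>

fun sless :: "'x::linorder list \<Rightarrow> 'x list \<Rightarrow> bool" where
  "sless [] v \<longleftrightarrow> False"
| "sless (x # u) [] \<longleftrightarrow> False"
| "sless (x # u) (y # v) \<longleftrightarrow> x < y \<or> x = y \<and> sless u v"

lemma word_less_iff: "word_less u v \<longleftrightarrow> sless u v \<or> strict_prefix v u"
  by (induction u v rule: sless.induct) auto

lemma word_less_irrefl [simp]: "\<not> word_less u u"
  by (induction u) auto

lemma word_less_trans: "word_less u v \<Longrightarrow> word_less v w \<Longrightarrow> word_less u w"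
proof (induction u v arbitrary: w rule: word_less.induct)
  case (2 x u) then show ?case by simp
next
  case (3 x u y v) then show ?case by (cases w) auto
qed simp

lemma word_less_linear: "word_less u v \<or> u = v \<or> word_less v u"
proof (induction u v rule: word_less.induct)
  case (1 v) then show ?case by (cases v) auto
qed auto

lemma word_less_asym: "word_less u v \<Longrightarrow> \<not> word_less v u"
  using word_less_trans word_less_irrefl by blast

lemma sless_imp_word_less: "sless u v \<Longrightarrow> word_less u v"
  by (simp add: word_less_iff)

lemma sless_append: "sless u v \<Longrightarrow> sless (u @ p) (v @ q)"
  by (induction u v rule: sless.induct) auto

lemma sless_append_left [simp]: "sless (p @ u) (p @ v) \<longleftrightarrow> sless u v"
  by (induction p) auto

lemma word_less_append_left [simp]: "word_less (p @ u) (p @ v) \<longleftrightarrow> word_less u v"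
  by (induction p) auto

lemma sless_trans: "sless u v \<Longrightarrow> sless v w \<Longrightarrow> sless u w"
proof (induction u v arbitrary: w rule: sless.induct)
  case (3 x u y v) then show ?case by (cases w) auto
qed auto

lemma word_less_same_length: "length u = length v \<Longrightarrow> word_less u v \<longleftrightarrow> sless u v"
  by (auto simp: word_less_iff strict_prefix_def prefix_def)

lemma not_sless_Nil [simp]: "\<not> sless u []"
  by (cases u) auto

lemma not_sless_prefix: "\<not> sless (p @ u) p" "\<not> sless p (p @ u)"
  by (induction p) auto

definition word_le :: "'x::linorder list \<Rightarrow> 'x list \<Rightarrow> bool" where
  "word_le u v \<longleftrightarrow> u = v \<or> word_less u v"

lemma word_le_refl [simp]: "word_le u u" by (simp add: word_le_def)

lemma word_le_trans: "word_le u v \<Longrightarrow> word_le v w \<Longrightarrow> word_le u w"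
  unfolding word_le_def using word_less_trans by blast

lemma word_le_less_trans: "word_le u v \<Longrightarrow> word_less v w \<Longrightarrow> word_less u w"
  unfolding word_le_def using word_less_trans by blast

lemma word_less_le_trans: "word_less u v \<Longrightarrow> word_le v w \<Longrightarrow> word_less u w"
  unfolding word_le_def using word_less_trans by blast

lemma not_word_less: "\<not> word_less u v \<longleftrightarrow> word_le v u"
  unfolding word_le_def using word_less_linear word_less_asym by blast

lemma word_le_append_left [simp]: "word_le (p @ u) (p @ v) \<longleftrightarrow> word_le u v"
  by (simp add: word_le_def)

lemma word_less_append_right:
  "length u = length v \<Longrightarrow> word_less u v \<Longrightarrow> word_less (u @ p) (v @ q)"
  by (simp add: word_less_same_length sless_append sless_imp_word_less)

lemma word_le_append_right: "length u = length v \<Longrightarrow> word_le u v \<Longrightarrow> word_le (u @ p) (v @ p)"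
  unfolding word_le_def using word_less_append_right by blast

lemma word_le_append:
  "length u = length u' \<Longrightarrow> word_le u u' \<Longrightarrow> word_le v v' \<Longrightarrow> word_le (u @ v) (u' @ v')"
  using word_le_append_right[of u u' v] word_le_append_left[of u' v v'] word_le_trans by blast


text \<open>
  Comparing \<open>u = v w\<close> with its rotation \<open>w v\<close> decides between \<open>w\<close> and \<open>u\<close> unless \<open>w\<close> is also a
  prefix of \<open>u\<close>. A border \<open>w\<close>, with \<open>u = w z = v w\<close>, is impossible: the two rotations \<open>w v\<close> and
  \<open>z w\<close> would give both \<open>v < z\<close> and \<open>z < v\<close>.
\<close>

lemma assoc_LS_suffix:
  assumes "assoc_LS u" "u = v @ w" "v \<noteq> []" "w \<noteq> []"
  shows "sless w u"
proof -
  have rot: "word_less (w @ v) u" using assms by (simp add: assoc_LS_def)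
  have "\<not> strict_prefix w u"
  proof
    assume "strict_prefix w u"
    then obtain z where z: "u = w @ z" "z \<noteq> []" by (auto simp: strict_prefix_def prefix_def)
    have len: "length v = length z" using z assms(2)
      by (metis add.commute add_left_cancel length_append)
    have "word_less (z @ w) u" using assms(1,4) z unfolding assoc_LS_def by blast
    then have "sless (z @ w) (v @ w)" using assms(2) len by (simp add: word_less_same_length)
    moreover have "sless v z" using rot z(1) len by (simp add: word_less_same_length)
    then have "sless (v @ w) (z @ w)" by (rule sless_append)
    ultimately show False using word_less_asym sless_imp_word_less by blast
  qed
  moreover have "length w < length u" using assms by simp
  then have "\<not> strict_prefix u w" "w \<noteq> u" by (auto dest: prefix_length_less)
  moreover have "\<not> sless u w"
  proof
    assume "sless u w"
    then have "sless u (w @ v)" using sless_append[of u w "[]" v] by simp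
    then show False using rot word_less_asym sless_imp_word_less by blast
  qed
  ultimately show ?thesis using word_less_linear[of u w] by (auto simp: word_less_iff)
qed

lemma assoc_LS_I:
  assumes "u \<noteq> []" "\<And>v w. v \<noteq> [] \<Longrightarrow> w \<noteq> [] \<Longrightarrow> u = v @ w \<Longrightarrow> sless w u"
  shows "assoc_LS u"
  unfolding assoc_LS_def
proof (intro conjI allI impI)
  fix v w assume "v \<noteq> [] \<and> w \<noteq> [] \<and> u = v @ w"
  then have "sless w u" using assms(2) by blast
  then show "word_less (w @ v) u" using sless_append[of w u v "[]"]
    by (simp add: sless_imp_word_less)
qed (rule assms(1))

lemma assoc_LS_singleton [simp]: "assoc_LS [x]"
  by (auto simp: assoc_LS_def Cons_eq_append_conv)

text \<open>
  The suffix \<open>v\<close> of \<open>u v\<close> is the critical one. It is strictly below \<open>u\<close> unless \<open>v = u z\<close>, and then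
  \<open>z\<close>, as a suffix of \<open>v\<close>, is below \<open>v\<close>. All shorter suffixes lie below \<open>v\<close>, and all longer ones
  begin with a suffix of \<open>u\<close>.
\<close>

lemma assoc_LS_append:
  assumes u: "assoc_LS u" and v: "assoc_LS v" and less: "word_less v u"
  shows "assoc_LS (u @ v)"
proof (rule assoc_LS_I)
  have ne: "u \<noteq> []" "v \<noteq> []" using u v by (auto simp: assoc_LS_def)
  then show "u @ v \<noteq> []" by simp
  have vuv: "sless v (u @ v)"
  proof (cases "sless v u")
    case True then show ?thesis using sless_append[of v u "[]" v] by simp
  next
    case False
    then obtain z where "v = u @ z" "z \<noteq> []"
      using less by (auto simp: word_less_iff strict_prefix_def prefix_def)
    then show ?thesis using assoc_LS_suffix[OF v _ ne(1)] by simp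
  qed
  fix p w assume p: "p \<noteq> []" and w: "w \<noteq> []" and eq: "u @ v = p @ w"
  from eq consider s where "u = p @ s" "w = s @ v" | s where "v = s @ w" "p = u @ s"
    by (auto simp: append_eq_append_conv2)
  then show "sless w (u @ v)"
  proof cases
    case 1
    show ?thesis
    proof (cases "s = []")
      case False
      then have "sless s u" using assoc_LS_suffix[OF u] 1 p by blast
      then show ?thesis using 1 sless_append by blast
    qed (use 1 vuv in simp)
  next
    case 2
    show ?thesis
    proof (cases "s = []")
      case False
      then show ?thesis using assoc_LS_suffix[OF v 2(1) _ w] vuv sless_trans by blast
    qed (use 2 vuv in simp)
  qed
qed

text \<open>
  Otherwise the word would lie below its own suffix \<open>w\<close>, or have \<open>w\<close> as a border.
\<close>

lemma assoc_LS_no_border: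
  assumes "assoc_LS (u @ w)" "w \<noteq> []" "u \<noteq> []" "u @ w = p @ q" shows "\<not> word_le p w \<or> p = []"
proof (rule ccontr)
  assume "\<not> (\<not> word_le p w \<or> p = [])"
  then consider "sless p w" | z where "p = w @ z"
    by (auto simp: word_le_def word_less_iff strict_prefix_def prefix_def)
  then show False
  proof cases
    case 1
    then have "sless (u @ w) w" using sless_append[of p w q "[]"] assms(4) by simp
    then show False using assoc_LS_suffix[OF assms(1) refl assms(3,2)]
      using word_less_asym sless_imp_word_less by blast
  next
    case 2
    then show False using assoc_LS_suffix[OF assms(1) refl assms(3,2)] assms(4)
        not_sless_prefix(2)[of w "z @ q"] by simp
  qed
qed

lemma assoc_LS_letter_le_hd:
  assumes "assoc_LS (a # u)" "y \<in> set u" shows "y \<le> a"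
proof -
  obtain p q where "u = p @ y # q" using assms(2) by (auto simp: in_set_conv_decomp)
  then have "sless (y # q) (a # u)" using assoc_LS_suffix[OF assms(1), of "a # p" "y # q"] by simp
  then show ?thesis by auto
qed

lemma word_ne [simp]: "word t \<noteq> []" "length (word t) > 0"
  by (induction t) auto

lemma nonassoc_LS_imp_assoc_LS: "nonassoc_LS t \<Longrightarrow> assoc_LS (word t)"
  by (cases t) auto

lemma nonassoc_LS_Br:
  "nonassoc_LS (Br s t) \<longleftrightarrow> nonassoc_LS s \<and> nonassoc_LS t \<and> word_less (word t) (word s) \<and>
     (\<forall>s1 s2. s = Br s1 s2 \<longrightarrow> word_le (word s2) (word t))"
  using assoc_LS_append[of "word s" "word t"]
    by (auto simp: word_le_def dest: nonassoc_LS_imp_assoc_LS)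

declare nonassoc_LS.simps(2) [simp del]

lemma word_less_append_prefix: "v \<noteq> [] \<Longrightarrow> word_less (u @ v) u"
  by (auto simp: word_less_iff strict_prefix_def)

text \<open>
  If \<open>(s, t)\<close> violates the condition on the right factor of \<open>s = (s1, s2)\<close>, then \<open>t\<close> is smaller than
  \<open>s2\<close>, so it can be absorbed first into \<open>s2\<close> and the result then into \<open>s1\<close>.
\<close>

lemma nonassoc_LS_append:
  assumes "nonassoc_LS s" "nonassoc_LS t" "word_less (word t) (word s)"
  shows "\<exists>r. nonassoc_LS r \<and> word r = word s @ word t"
  using assms
proof (induction s arbitrary: t)
  case (Letter x)
  then have "nonassoc_LS (Br (Letter x) t)" by (simp add: nonassoc_LS_Br)
  then show ?case by (metis word.simps(2))
next
  case (Br s1 s2)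
  show ?case
  proof (cases "word_le (word s2) (word t)")
    case True
    then have "nonassoc_LS (Br (Br s1 s2) t)" using Br.prems by (subst nonassoc_LS_Br) auto
    then show ?thesis by (metis word.simps(2))
  next
    case False
    then have "word_less (word t) (word s2)" by (simp add: not_word_less[symmetric])
    then obtain r where r: "nonassoc_LS r" "word r = word s2 @ word t"
      using Br.IH(2)[of t] Br.prems unfolding nonassoc_LS_Br by blast
    have "assoc_LS (word s1 @ word r)"
      using assoc_LS_append[OF nonassoc_LS_imp_assoc_LS[OF Br.prems(1)] nonassoc_LS_imp_assoc_LS[OF
          Br.prems(2)] Br.prems(3)] r
      by simp
    then have "sless (word r) (word s1 @ word r)" by (rule assoc_LS_suffix) auto
    then have "word_less (word r) (word s1)"
      using word_less_append_prefix[of "word r" "word s1"] sless_imp_word_less word_less_trans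
        by fastforce
    then obtain q where "nonassoc_LS q" "word q = word s1 @ word r"
      using Br.IH(1)[of r] Br.prems r(1) unfolding nonassoc_LS_Br by blast
    then show ?thesis using r by auto
  qed
qed

text \<open>
  Unfolding left factors writes \<open>s1 s2\<close> as a letter followed by right factors \<open>t\<^sub>1 \<le> \<dots> \<le> t\<^sub>k = s2\<close>. A
  proper suffix begins with a nonempty suffix \<open>v\<close> of some \<open>t\<^sub>i\<close>, and \<open>v \<le> t\<^sub>i \<le> s2\<close>. Both the uniqueness
  of bracketings and the location of forbidden factors in products rest on this.
\<close>

lemma nonassoc_LS_suffix_prefix:
  assumes "nonassoc_LS (Br s1 s2)" "word s1 @ word s2 = p @ w" "p \<noteq> []" "w \<noteq> []"
  shows "\<exists>v z. w = v @ z \<and> v \<noteq> [] \<and> word_le v (word s2)"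
  using assms
proof (induction s1 arbitrary: s2 w)
  case (Letter x)
  then obtain p' where p': "word s2 = p' @ w" by (auto simp: Cons_eq_append_conv)
  have "word_le w (word s2)"
  proof (cases "p' = []")
    case False
    then show ?thesis
      using assoc_LS_suffix[OF nonassoc_LS_imp_assoc_LS p' _ Letter.prems(4)] Letter.prems(1)
      by (auto simp: word_le_def sless_imp_word_less nonassoc_LS_Br)
  qed (use p' in simp)
  then show ?case using Letter.prems(4) by blast
next
  case (Br s11 s12)
  consider p' where "word s2 = p' @ w" | w' where "word (Br s11 s12) = p @ w'" "w = w' @ word s2"
    using Br.prems(2) unfolding append_eq_append_conv2[of "word (Br s11 s12)"] by blast
  then show ?case
  proof cases
    case 1
    have "word_le w (word s2)"
    proof (cases "p' = []")
      case False
      then show ?thesis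
        using assoc_LS_suffix[OF nonassoc_LS_imp_assoc_LS 1 _ Br.prems(4)] Br.prems(1)
        by (auto simp: word_le_def sless_imp_word_less nonassoc_LS_Br)
    qed (use 1 in simp)
    then show ?thesis using Br.prems(4) by blast
  next
    case 2
    show ?thesis
    proof (cases "w' = []")
      case False
      have LS: "nonassoc_LS (Br s11 s12)" "word_le (word s12) (word s2)"
        using Br.prems(1) by (auto simp: nonassoc_LS_Br)
      then obtain v z where "w' = v @ z" "v \<noteq> []" "word_le v (word s12)"
        using Br.IH(1)[OF LS(1) _ Br.prems(3) False] 2(1) by auto
      then show ?thesis using 2(2) LS(2) word_le_trans by auto
    next
      case True
      then show ?thesis using 2(2) word_ne(1)[of s2]
        by (metis append.left_neutral append.right_neutral word_le_refl)
    qed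
  qed
qed

text \<open>
  A longer Lyndon--Shirshov suffix would begin with some \<open>v\<close> that is at most its own suffix \<open>word t\<close>, which
  \<open>assoc_LS_no_border\<close> excludes.
\<close>

lemma nonassoc_LS_longest_suffix:
  assumes "nonassoc_LS (Br s t)" "assoc_LS w" "word s @ word t = p @ w" "p \<noteq> []"
  shows "length w \<le> length (word t)"
proof (rule ccontr)
  assume "\<not> ?thesis"
  then obtain w' where w': "w = w' @ word t" "w' \<noteq> []" "word s = p @ w'"
    using assms(3) unfolding append_eq_append_conv2[of "word s"] by force
  show False
  proof (cases s)
    case (Letter x) then show ?thesis using w' assms(4) by (auto simp: Cons_eq_append_conv)
  next
    case (Br s1 s2)
    then have LS: "nonassoc_LS (Br s1 s2)" "word_le (word s2) (word t)"
      using assms(1) by (auto simp: nonassoc_LS_Br)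
    then obtain v z where v: "w' = v @ z" "v \<noteq> []" "word_le v (word s2)"
      using nonassoc_LS_suffix_prefix[OF LS(1) _ assms(4) w'(2)] w'(3) Br by auto
    then show ?thesis
      using assoc_LS_no_border[of w' "word t" v "z @ word t"] assms(2) w' LS(2) word_le_trans
        by auto
  qed
qed

lemma nonassoc_LS_unique:
  assumes "nonassoc_LS s" "nonassoc_LS t" "word s = word t"
  shows "s = t"
  using assms
proof (induction s arbitrary: t)
  case (Letter x)
  then show ?case by (cases t) (auto simp: Cons_eq_append_conv)
next
  case (Br s1 s2)
  then obtain t1 t2 where t: "t = Br t1 t2" by (cases t) (auto simp: append_eq_Cons_conv)
  have eq: "word s1 @ word s2 = word t1 @ word t2" using Br.prems t by simp
  have "length (word s2) = length (word t2)"
    using nonassoc_LS_longest_suffix[of s1 s2 "word t2" "word t1"]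
      nonassoc_LS_longest_suffix[of t1 t2 "word s2" "word s1"] Br.prems t eq
    by (auto simp: nonassoc_LS_Br nonassoc_LS_imp_assoc_LS intro!: le_antisym)
  then show ?case using Br eq t by (auto simp: nonassoc_LS_Br)
qed

section \<open>Forbidden factors and lexicographic normal forms of traces\<close>

text \<open>
  What it means for a word to contain a forbidden one, stated without bracketings.
\<close>

definition commuting_factor :: "'x::linorder set set \<Rightarrow> 'x list \<Rightarrow> bool" where
  "commuting_factor E u \<longleftrightarrow> (\<exists>p a x b q. u = p @ (a # x) @ b # q \<and> b < a \<and> (\<forall>y\<in>set x. y < b) \<and>
     (\<forall>y\<in>set (a # x). {b, y} \<in> E))"

lemma nonassoc_LS_exists_max_hd:
  assumes "\<forall>y\<in>set x. y < a"
  shows "\<exists>t. nonassoc_LS t \<and> word t = a # x"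
  using assms
proof (induction x rule: rev_induct)
  case Nil
  have "nonassoc_LS (Letter a) \<and> word (Letter a) = [a]" by simp
  then show ?case by blast
next
  case (snoc y x)
  then obtain t where t: "nonassoc_LS t" "word t = a # x" by auto
  have "nonassoc_LS (Letter y)" "word_less (word (Letter y)) (word t)" using snoc.prems t by auto
  then show ?case using nonassoc_LS_append[OF t(1), of "Letter y"] t(2) by auto
qed

text \<open>
  The greatest letter is first because the word is Lyndon--Shirshov, and \<open>b\<close> occurs only at the end
  because it is joined to all earlier letters and there are no loops.
\<close>

lemma forbidden_word:
  assumes "\<And>x. {x, x} \<notin> E" "forbidden E s"
  shows "\<exists>a x b. word s = (a # x) @ [b] \<and> b < a \<and> (\<forall>y\<in>set x. y < b) \<and> (\<forall>y\<in>set (a # x). {b, y} \<in> E)"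
proof -
  from assms(2) obtain t b a c where s: "nonassoc_LS s" "s = Br t (Letter b)"
    and a: "greatest_letter (word s) a" "count_list (word s) a = 1"
    and c: "greatest_letter (word s) c" "b \<noteq> c" "\<forall>y\<in>set (word s). y \<noteq> c \<longrightarrow> y \<le> b"
    and E: "\<forall>x\<in>set (word t). {b, x} \<in> E"
    unfolding forbidden_def second_letter_def by blast
  have ca: "c = a" using a(1) c(1) unfolding greatest_letter_def by (meson order.antisym)
  obtain d x where d: "word t = d # x" using word_ne(1)[of t] by (cases "word t") auto
  have ws: "word s = d # x @ [b]" using s(2) d by simp
  have "\<forall>y\<in>set (x @ [b]). y \<le> d"
    using assoc_LS_letter_le_hd[of d "x @ [b]"] nonassoc_LS_imp_assoc_LS[OF s(1)] ws by simp
  then have da: "d = a" using a(1) ws unfolding greatest_letter_def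
    by (metis list.set_intros(1) order.antisym set_ConsD order.refl)
  have bx: "b \<notin> set (word t)" using E assms(1) by blast
  have ax: "a \<notin> set x" using a(2) ws da by (auto simp: count_list_0_iff split: if_splits)
  have "b < a" using a(1) c(2) ca ws unfolding greatest_letter_def by auto
  moreover have "y < b" if "y \<in> set x" for y
  proof -
    have "y \<noteq> b" "y \<noteq> c" using that bx ax d ca by auto
    then show ?thesis using c(3) that ws by (auto simp: order.strict_iff_order)
  qed
  ultimately show ?thesis using ws da d E by (intro exI[of _ a] exI[of _ x] exI[of _ b]) auto
qed

lemma commuting_factor_forbidden:
  assumes "b < a" "\<forall>y\<in>set x. y < b" "\<forall>y\<in>set (a # x). {b, y} \<in> E"
  shows "\<exists>s. forbidden E s \<and> word s = (a # x) @ [b]"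
proof -
  have "\<forall>y\<in>set x. y < a" using assms by auto
  then obtain t where t: "nonassoc_LS t" "word t = a # x" using nonassoc_LS_exists_max_hd by blast
  have "word_le (word t2) [b]" if "t = Br t1 t2" for t1 t2
  proof -
    obtain e z where e: "word t2 = e # z" using word_ne(1)[of t2] by (cases "word t2") auto
    have "e \<in> set x" using t(2) that e word_ne(1)[of t1] by (auto simp: append_eq_Cons_conv)
    then show ?thesis using assms(2) e by (auto simp: word_le_def)
  qed
  then have LS: "nonassoc_LS (Br t (Letter b))"
    using t assms(1) by (subst nonassoc_LS_Br) auto
  have g: "greatest_letter (word (Br t (Letter b))) a"
    using t(2) assms(1,2) by (auto simp: greatest_letter_def)
  have "a \<notin> set x" using assms(1,2) by auto
  then have "count_list (word (Br t (Letter b))) a = 1"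
    using t(2) assms(1,2) by (auto simp: count_list_0_iff)
  moreover have "second_letter (word (Br t (Letter b))) b"
    unfolding second_letter_def using g t(2) assms(1,2) by (intro exI[of _ a]) auto
  ultimately have "forbidden E (Br t (Letter b))"
    unfolding forbidden_def using LS g t(2) assms(3)
      by (intro conjI exI[of _ t] exI[of _ b] exI[of _ a]) auto
  then show ?thesis using t(2) by (intro exI[of _ "Br t (Letter b)"]) simp
qed

lemma pc_basis_words_iff:
  assumes "\<And>x. {x, x} \<notin> E"
  shows "t \<in> pc_basis_words V E \<longleftrightarrow> set (word t) \<subseteq> V \<and> nonassoc_LS t \<and> \<not> commuting_factor E (word t)"
proof -
  have "(\<exists>s. forbidden E s \<and> sublist (word s) (word t)) \<longleftrightarrow> commuting_factor E (word t)"
  proof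
    assume "\<exists>s. forbidden E s \<and> sublist (word s) (word t)"
    then obtain s p q where s: "forbidden E s" "word t = p @ word s @ q" by (auto simp: sublist_def)
    obtain a x b where "word s = (a # x) @ [b]" "b < a" "\<forall>y\<in>set x. y < b"
        "\<forall>y\<in>set (a # x). {b, y} \<in> E"
      using forbidden_word[OF assms s(1)] by blast
    then show "commuting_factor E (word t)" unfolding commuting_factor_def using s(2)
      by (intro exI[of _ p] exI[of _ a] exI[of _ x] exI[of _ b] exI[of _ q]) auto
  next
    assume "commuting_factor E (word t)"
    then obtain p a x b q where f: "word t = p @ (a # x) @ b # q" "b < a" "\<forall>y\<in>set x. y < b"
        "\<forall>y\<in>set (a # x). {b, y} \<in> E"
      unfolding commuting_factor_def by blast
    obtain s where "forbidden E s" "word s = (a # x) @ [b]"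
      using commuting_factor_forbidden[OF f(2-4)] by blast
    then show "\<exists>s. forbidden E s \<and> sublist (word s) (word t)" using f(1)
      by (intro exI[of _ s]) (auto simp: sublist_def)
  qed
  then show ?thesis by (auto simp: pc_basis_words_def)
qed

text \<open>
  Equality in the monoid in which joined letters commute, expressed by projections: two words
  are equal there iff they agree after erasing all letters but \<open>x\<close> and \<open>y\<close>, for all \<open>x\<close>, \<open>y\<close> that
  are not joined (including \<open>x = y\<close>). In this form, congruence and cancellation on the left are
  immediate.
\<close>

definition trace_eq :: "'x set set \<Rightarrow> 'x list \<Rightarrow> 'x list \<Rightarrow> bool" where
  "trace_eq E u v \<longleftrightarrow> (\<forall>x y. {x, y} \<notin> E \<longrightarrow> filter (\<lambda>z. z \<in> {x, y}) u = filter (\<lambda>z. z \<in> {x, y}) v)"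

lemma trace_eq_refl [simp]: "trace_eq E u u"
  by (simp add: trace_eq_def)

lemma trace_eq_append_left [simp]: "trace_eq E (p @ u) (p @ v) \<longleftrightarrow> trace_eq E u v"
  by (simp add: trace_eq_def)

lemma trace_eq_sym: "trace_eq E u v \<Longrightarrow> trace_eq E v u"
  by (simp add: trace_eq_def)

lemma trace_eq_trans: "trace_eq E u v \<Longrightarrow> trace_eq E v w \<Longrightarrow> trace_eq E u w"
  by (simp add: trace_eq_def)

lemma trace_eq_commute: "{x, y} \<in> E \<Longrightarrow> trace_eq E (x # y # w) (y # x # w)"
  by (auto simp: trace_eq_def insert_commute)

lemma trace_eq_mset:
  assumes "\<And>x. {x, x} \<notin> E" "trace_eq E u v"
  shows "mset u = mset v"
proof (rule multiset_eqI)
  fix x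
  have "filter (\<lambda>z. z \<in> {x, x}) u = filter (\<lambda>z. z \<in> {x, x}) v"
    using assms(2) assms(1)[of x] unfolding trace_eq_def by blast
  moreover have "(\<lambda>z. z \<in> {x, x}) = (=) x" by auto
  ultimately have "filter ((=) x) u = filter ((=) x) v" by simp
  then show "count (mset u) x = count (mset v) x"
    by (simp add: count_mset count_list_eq_length_filter)
qed

lemma last_max_decomp:
  assumes "b < (a::'x::linorder)" "\<forall>y\<in>set x. y \<noteq> b"
  shows "\<exists>p a' x'. a # x = p @ a' # x' \<and> b < a' \<and> (\<forall>y\<in>set x'. y < b)"
  using assms
proof (induction x rule: rev_induct)
  case (snoc y x)
  show ?case
  proof (cases "y < b")
    case True
    from snoc obtain p a' x' where "a # x = p @ a' # x'" "b < a'" "\<forall>y\<in>set x'. y < b" by auto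
    then show ?thesis using True by (intro exI[of _ p] exI[of _ a'] exI[of _ "x' @ [y]"]) auto
  next
    case False
    then show ?thesis using snoc.prems
      by (intro exI[of _ "a # x"] exI[of _ y] exI[of _ "[]"]) auto
  qed
qed (intro exI[of _ "[]"], auto)

lemma sless_decomp: "sless v u \<Longrightarrow> \<exists>p b v' a u'. v = p @ b # v' \<and> u = p @ a # u' \<and> b < a"
proof (induction v u rule: sless.induct)
  case (3 x u y v)
  then consider "x < y" | "x = y" "sless u v" by auto
  then show ?case
  proof cases
    case 1 then show ?thesis by (intro exI[of _ "[]"]) auto
  next
    case 2
    then obtain p b v' a u' where "u = p @ b # v'" "v = p @ a # u'" "b < a" using 3 by blast
    then show ?thesis using 2 by (intro exI[of _ "x # p"]) auto
  qed
qed auto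

text \<open>
  At the first difference, \<open>v\<close> has \<open>b\<close> where \<open>u\<close> has some \<open>a > b\<close>. Hence \<open>u\<close> contains \<open>a x b\<close> with a
  later \<open>b\<close>, and this \<open>b\<close> commutes past all of \<open>a x\<close>, since a projection to \<open>b\<close> and a letter it does
  not commute with would tell \<open>u\<close> and \<open>v\<close> apart. Starting at the last letter of \<open>a x\<close> above \<open>b\<close>
  gives the factor.
\<close>

lemma trace_eq_less_commuting_factor:
  assumes loop: "\<And>x. {x, x} \<notin> E" and tr: "trace_eq E u v" and less: "word_less v u"
  shows "commuting_factor E u"
proof -
  have len: "length u = length v" using trace_eq_mset[OF loop tr] by (metis size_mset)
  then obtain p b v' a u' where d: "v = p @ b # v'" "u = p @ a # u'" "b < a"
    using less sless_decomp by (metis word_less_same_length)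
  have tr': "trace_eq E (a # u') (b # v')" using tr d by simp
  then have "mset (a # u') = mset (b # v')" by (rule trace_eq_mset[OF loop])
  then have "b \<in> set (a # u')" by (metis list.set_intros(1) mset_eq_setD)
  then have "b \<in> set u'" using d(3) by auto
  then obtain x q where x: "u' = x @ b # q" "b \<notin> set x" using split_list_first by metis
  have E: "{b, y} \<in> E" if y: "y \<in> set (a # x)" for y
  proof (rule ccontr)
    assume n: "{b, y} \<notin> E"
    have yb: "y \<noteq> b" using y x d(3) by auto
    let ?f = "filter (\<lambda>z. z \<in> {b, y})"
    have eq: "?f ((a # x) @ b # q) = ?f (b # v')" using tr' n x(1) unfolding trace_eq_def
      by (metis append_Cons)
    have "y \<in> set (?f (a # x))" using y unfolding set_filter by blast
    then obtain c r where c: "?f (a # x) = c # r" by (metis list.set_cases)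
    have "c \<in> set (?f (a # x))" using c by simp
    then have "c \<in> set (a # x)" unfolding set_filter by blast
    then have "c \<noteq> b" using x d(3) by auto
    moreover have "?f ((a # x) @ b # q) = c # (r @ ?f (b # q))" unfolding filter_append c by simp
    ultimately show False using eq by simp
  qed
  obtain p' a' x' where p': "a # x = p' @ a' # x'" "b < a'" "\<forall>y\<in>set x'. y < b"
    using last_max_decomp[OF d(3), of x] x(2) by blast
  have "\<forall>y\<in>set (a' # x'). {b, y} \<in> E" using E unfolding p'(1) by auto
  moreover have "u = (p @ p') @ (a' # x') @ b # q" using d(2) x(1) p'(1)
    by (metis append.assoc append_Cons)
  ultimately show ?thesis unfolding commuting_factor_def using p' by blast
qed

section \<open>Linear spans in modules and Lie algebras\<close>

inductive_set lin_span :: "('r, 'm) ring_scheme \<Rightarrow> ('r, 'a, 'n) module_scheme \<Rightarrow> 'a set \<Rightarrow> 'a set"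
  for R M S where
  zero: "\<zero>\<^bsub>M\<^esub> \<in> lin_span R M S"
| add_smult: "\<lbrakk>r \<in> carrier R; b \<in> S; m \<in> lin_span R M S\<rbrakk> \<Longrightarrow> r \<odot>\<^bsub>M\<^esub> b \<oplus>\<^bsub>M\<^esub> m \<in> lin_span R M S"

lemma lin_span_mono: 
  assumes "S \<subseteq> T" shows "lin_span R M S \<subseteq> lin_span R M T"
proof
  fix m assume "m \<in> lin_span R M S"
  then show "m \<in> lin_span R M T" by induction (use assms in \<open>auto intro: lin_span.intros\<close>)
qed

context module
begin

lemma lin_span_closed: 
  assumes "S \<subseteq> carrier M" shows "lin_span R M S \<subseteq> carrier M"
proof
  fix m assume "m \<in> lin_span R M S"
  then show "m \<in> carrier M" by induction (use assms in auto)
qed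

lemma lin_span_add:
  assumes "S \<subseteq> carrier M" "x \<in> lin_span R M S" "y \<in> lin_span R M S"
  shows "x \<oplus>\<^bsub>M\<^esub> y \<in> lin_span R M S"
  using assms(2)
proof induction
  case zero
  then show ?case using assms lin_span_closed[OF assms(1)] by auto
next
  case (add_smult r b m)
  then have "(r \<odot>\<^bsub>M\<^esub> b \<oplus>\<^bsub>M\<^esub> m) \<oplus>\<^bsub>M\<^esub> y = r \<odot>\<^bsub>M\<^esub> b \<oplus>\<^bsub>M\<^esub> (m \<oplus>\<^bsub>M\<^esub> y)"
    using assms lin_span_closed[OF assms(1)] by (intro M.a_assoc) auto
  then show ?case using add_smult by (auto intro: lin_span.intros)
qed

lemma lin_span_smult:
  assumes "S \<subseteq> carrier M" "r \<in> carrier R" "x \<in> lin_span R M S"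
  shows "r \<odot>\<^bsub>M\<^esub> x \<in> lin_span R M S"
  using assms(3)
proof induction
  case zero
  then show ?case using assms by (auto intro: lin_span.intros)
next
  case (add_smult s b m)
  then have "r \<odot>\<^bsub>M\<^esub> (s \<odot>\<^bsub>M\<^esub> b \<oplus>\<^bsub>M\<^esub> m) = (r \<otimes> s) \<odot>\<^bsub>M\<^esub> b \<oplus>\<^bsub>M\<^esub> r \<odot>\<^bsub>M\<^esub> m"
    using assms lin_span_closed[OF assms(1)] by (auto simp: smult_r_distr smult_assoc1 subset_iff)
  then show ?case using add_smult assms by (auto intro: lin_span.intros)
qed

lemma lin_span_base:
  assumes "S \<subseteq> carrier M" "x \<in> S" shows "x \<in> lin_span R M S"
  using lin_span.add_smult[of "\<one>" R x S "\<zero>\<^bsub>M\<^esub>" M] lin_span.zero[of M R S] assms by auto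

lemma lin_span_uminus:
  assumes "S \<subseteq> carrier M" "x \<in> lin_span R M S" shows "\<ominus>\<^bsub>M\<^esub> x \<in> lin_span R M S"
proof -
  have x: "x \<in> carrier M" using assms lin_span_closed by blast
  have "\<ominus>\<^bsub>M\<^esub> x = (\<ominus> \<one>) \<odot>\<^bsub>M\<^esub> x" using smult_l_minus[of \<one> x] x by simp
  then show ?thesis using lin_span_smult[OF assms(1) _ assms(2), of "\<ominus> \<one>"] by simp
qed

text \<open>
  Converts the inductively built combinations to finite sums over distinct indices, merging the
  coefficients of equal indices.
\<close>

lemma lin_span_image_finsum:
  assumes "v \<in> B \<rightarrow> carrier M" "m \<in> lin_span R M (v ` B)"
  shows "\<exists>F c. finite F \<and> F \<subseteq> B \<and> c \<in> F \<rightarrow> carrier R \<and> m = (\<Oplus>\<^bsub>M\<^esub>i\<in>F. c i \<odot>\<^bsub>M\<^esub> v i)"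
  using assms(2)
proof induction
  case zero
  show ?case by (intro exI[of _ "{}"]) auto
next
  case (add_smult r b m)
  then obtain i F c where i: "i \<in> B" "b = v i"
    and F: "finite F" "F \<subseteq> B" "c \<in> F \<rightarrow> carrier R" "m = (\<Oplus>\<^bsub>M\<^esub>i\<in>F. c i \<odot>\<^bsub>M\<^esub> v i)" by blast
  let ?d = "c(i := if i \<in> F then r \<oplus> c i else r)"
  have vc: "\<And>j. j \<in> B \<Longrightarrow> v j \<in> carrier M" using assms(1) by auto
  have cc: "\<And>j. j \<in> F \<Longrightarrow> c j \<in> carrier R" using F(3) by auto
  have d: "?d \<in> insert i F \<rightarrow> carrier R" using cc add_smult by auto
  have trm: "\<And>j. j \<in> F \<Longrightarrow> c j \<odot>\<^bsub>M\<^esub> v j \<in> carrier M" using vc cc F(2) by auto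
  have rest: "(\<Oplus>\<^bsub>M\<^esub>j\<in>F - {i}. c j \<odot>\<^bsub>M\<^esub> v j) = (\<Oplus>\<^bsub>M\<^esub>j\<in>F - {i}. ?d j \<odot>\<^bsub>M\<^esub> v j)"
    by (rule M.finsum_cong') (use trm in auto)
  have rc: "(\<Oplus>\<^bsub>M\<^esub>j\<in>F - {i}. c j \<odot>\<^bsub>M\<^esub> v j) \<in> carrier M" by (rule M.finsum_closed) (use trm in auto)
  have dtrm: "?d j \<odot>\<^bsub>M\<^esub> v j \<in> carrier M" if "j \<in> insert i F" for j
    using funcset_mem[OF d that] vc F(2) i(1) that by blast
  have ins: "(\<Oplus>\<^bsub>M\<^esub>j\<in>insert i F. ?d j \<odot>\<^bsub>M\<^esub> v j) = ?d i \<odot>\<^bsub>M\<^esub> v i \<oplus>\<^bsub>M\<^esub> (\<Oplus>\<^bsub>M\<^esub>j\<in>F - {i}. c j \<odot>\<^bsub>M\<^esub> v j)"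
  proof -
    have "(\<Oplus>\<^bsub>M\<^esub>j\<in>insert i (F - {i}). ?d j \<odot>\<^bsub>M\<^esub> v j) = ?d i \<odot>\<^bsub>M\<^esub> v i \<oplus>\<^bsub>M\<^esub> (\<Oplus>\<^bsub>M\<^esub>j\<in>F - {i}. ?d j \<odot>\<^bsub>M\<^esub> v j)"
      by (rule M.finsum_insert) (use F(1) dtrm in \<open>auto simp del: fun_upd_apply\<close>)
    then show ?thesis using rest by simp
  qed
  have "r \<odot>\<^bsub>M\<^esub> b \<oplus>\<^bsub>M\<^esub> m = (\<Oplus>\<^bsub>M\<^esub>j\<in>insert i F. ?d j \<odot>\<^bsub>M\<^esub> v j)"
  proof (cases "i \<in> F")
    case False
    then show ?thesis using ins i F by simp
  next
    case True
    then have "m = (\<Oplus>\<^bsub>M\<^esub>j\<in>insert i (F - {i}). c j \<odot>\<^bsub>M\<^esub> v j)" using F(4) by (simp add: insert_absorb)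
    also have "\<dots> = c i \<odot>\<^bsub>M\<^esub> v i \<oplus>\<^bsub>M\<^esub> (\<Oplus>\<^bsub>M\<^esub>j\<in>F - {i}. c j \<odot>\<^bsub>M\<^esub> v j)"
      by (rule M.finsum_insert) (use F trm True in auto)
    finally show ?thesis using ins i True rc cc vc add_smult(1)
      by (simp add: smult_l_distr M.a_assoc)
  qed
  then show ?case using F i d by (intro exI[of _ "insert i F"] exI[of _ ?d]) auto
qed

end

context nonassoc_algebra
begin

lemma prod_zero_left [simp]:
  assumes "x \<in> carrier A" shows "\<zero>\<^bsub>A\<^esub> \<otimes>\<^bsub>A\<^esub> x = \<zero>\<^bsub>A\<^esub>"
proof -
  have "\<zero>\<^bsub>A\<^esub> \<otimes>\<^bsub>A\<^esub> x \<oplus>\<^bsub>A\<^esub> \<zero>\<^bsub>A\<^esub> \<otimes>\<^bsub>A\<^esub> x = \<zero>\<^bsub>A\<^esub> \<otimes>\<^bsub>A\<^esub> x"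
    using prod_l_distr[of "\<zero>\<^bsub>A\<^esub>" "\<zero>\<^bsub>A\<^esub>" x] assms by simp
  then show ?thesis using M.add.r_cancel_one prod_closed assms by simp
qed

lemma prod_zero_right [simp]:
  assumes "x \<in> carrier A" shows "x \<otimes>\<^bsub>A\<^esub> \<zero>\<^bsub>A\<^esub> = \<zero>\<^bsub>A\<^esub>"
proof -
  have "x \<otimes>\<^bsub>A\<^esub> \<zero>\<^bsub>A\<^esub> \<oplus>\<^bsub>A\<^esub> x \<otimes>\<^bsub>A\<^esub> \<zero>\<^bsub>A\<^esub> = x \<otimes>\<^bsub>A\<^esub> \<zero>\<^bsub>A\<^esub>"
    using prod_r_distr[of x "\<zero>\<^bsub>A\<^esub>" "\<zero>\<^bsub>A\<^esub>"] assms by simp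
  then show ?thesis using M.add.r_cancel_one prod_closed assms by simp
qed

lemma prod_lin_span_left:
  assumes "S \<subseteq> carrier A" "T \<subseteq> carrier A" "x \<in> lin_span R A S" "y \<in> carrier A"
    and "\<And>b. b \<in> S \<Longrightarrow> b \<otimes>\<^bsub>A\<^esub> y \<in> lin_span R A T"
  shows "x \<otimes>\<^bsub>A\<^esub> y \<in> lin_span R A T"
  using assms(3)
proof induction
  case zero
  then show ?case using assms by (simp add: lin_span.zero)
next
  case (add_smult r b m)
  then have "(r \<odot>\<^bsub>A\<^esub> b \<oplus>\<^bsub>A\<^esub> m) \<otimes>\<^bsub>A\<^esub> y = r \<odot>\<^bsub>A\<^esub> (b \<otimes>\<^bsub>A\<^esub> y) \<oplus>\<^bsub>A\<^esub> m \<otimes>\<^bsub>A\<^esub> y"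
    using assms(1,4) lin_span_closed[OF assms(1)]
      by (auto simp: prod_l_distr prod_smult_l subset_iff)
  then show ?case using add_smult assms by (auto intro!: lin_span_add lin_span_smult)
qed

lemma prod_lin_span_right:
  assumes "S \<subseteq> carrier A" "T \<subseteq> carrier A" "x \<in> lin_span R A S" "y \<in> carrier A"
    and "\<And>b. b \<in> S \<Longrightarrow> y \<otimes>\<^bsub>A\<^esub> b \<in> lin_span R A T"
  shows "y \<otimes>\<^bsub>A\<^esub> x \<in> lin_span R A T"
  using assms(3)
proof induction
  case zero
  then show ?case using assms by (simp add: lin_span.zero)
next
  case (add_smult r b m)
  then have "y \<otimes>\<^bsub>A\<^esub> (r \<odot>\<^bsub>A\<^esub> b \<oplus>\<^bsub>A\<^esub> m) = r \<odot>\<^bsub>A\<^esub> (y \<otimes>\<^bsub>A\<^esub> b) \<oplus>\<^bsub>A\<^esub> y \<otimes>\<^bsub>A\<^esub> m"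
    using assms(1,4) lin_span_closed[OF assms(1)]
      by (auto simp: prod_r_distr prod_smult_r subset_iff)
  then show ?case using add_smult assms by (auto intro!: lin_span_add lin_span_smult)
qed

end

context lie_algebra
begin

lemma anticommute:
  assumes "x \<in> carrier L" "y \<in> carrier L" shows "x \<otimes>\<^bsub>L\<^esub> y = \<ominus>\<^bsub>L\<^esub> (y \<otimes>\<^bsub>L\<^esub> x)"
proof -
  have "\<zero>\<^bsub>L\<^esub> = (x \<oplus>\<^bsub>L\<^esub> y) \<otimes>\<^bsub>L\<^esub> (x \<oplus>\<^bsub>L\<^esub> y)" using assms by (simp add: alternating)
  also have "\<dots> = x \<otimes>\<^bsub>L\<^esub> (x \<oplus>\<^bsub>L\<^esub> y) \<oplus>\<^bsub>L\<^esub> y \<otimes>\<^bsub>L\<^esub> (x \<oplus>\<^bsub>L\<^esub> y)"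
    by (rule prod_l_distr) (use assms in auto)
  also have "\<dots> = x \<otimes>\<^bsub>L\<^esub> y \<oplus>\<^bsub>L\<^esub> y \<otimes>\<^bsub>L\<^esub> x"
    using assms by (simp add: prod_r_distr alternating prod_closed)
  finally have "x \<otimes>\<^bsub>L\<^esub> y \<oplus>\<^bsub>L\<^esub> y \<otimes>\<^bsub>L\<^esub> x = \<zero>\<^bsub>L\<^esub>" by simp
  then show ?thesis using M.minus_equality[of "x \<otimes>\<^bsub>L\<^esub> y" "y \<otimes>\<^bsub>L\<^esub> x"] assms prod_closed by simp
qed

lemma leibniz:
  assumes "x \<in> carrier L" "y \<in> carrier L" "z \<in> carrier L"
  shows "(x \<otimes>\<^bsub>L\<^esub> y) \<otimes>\<^bsub>L\<^esub> z = (x \<otimes>\<^bsub>L\<^esub> z) \<otimes>\<^bsub>L\<^esub> y \<oplus>\<^bsub>L\<^esub> x \<otimes>\<^bsub>L\<^esub> (y \<otimes>\<^bsub>L\<^esub> z)"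
proof -
  define p where "p = (x \<otimes>\<^bsub>L\<^esub> y) \<otimes>\<^bsub>L\<^esub> z"
  define q where "q = (x \<otimes>\<^bsub>L\<^esub> z) \<otimes>\<^bsub>L\<^esub> y"
  define s where "s = x \<otimes>\<^bsub>L\<^esub> (y \<otimes>\<^bsub>L\<^esub> z)"
  note c = assms prod_closed
  have cl: "p \<in> carrier L" "q \<in> carrier L" "s \<in> carrier L" using c
    by (simp_all add: p_def q_def s_def)
  have 1: "(y \<otimes>\<^bsub>L\<^esub> z) \<otimes>\<^bsub>L\<^esub> x = \<ominus>\<^bsub>L\<^esub> s" using anticommute[of "y \<otimes>\<^bsub>L\<^esub> z" x] c by (simp add: s_def)
  have "(z \<otimes>\<^bsub>L\<^esub> x) \<otimes>\<^bsub>L\<^esub> y \<oplus>\<^bsub>L\<^esub> q = \<zero>\<^bsub>L\<^esub>"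
    using anticommute[of z x] c prod_l_distr[of "z \<otimes>\<^bsub>L\<^esub> x" "x \<otimes>\<^bsub>L\<^esub> z" y]
    by (simp add: q_def M.l_neg)
  then have 2: "(z \<otimes>\<^bsub>L\<^esub> x) \<otimes>\<^bsub>L\<^esub> y = \<ominus>\<^bsub>L\<^esub> q" using M.minus_equality c cl by metis
  have "p \<oplus>\<^bsub>L\<^esub> (\<ominus>\<^bsub>L\<^esub> s \<oplus>\<^bsub>L\<^esub> \<ominus>\<^bsub>L\<^esub> q) = \<zero>\<^bsub>L\<^esub>"
    using jacobi[OF assms] 1 2 by (simp add: jacobian_def p_def)
  moreover have "\<ominus>\<^bsub>L\<^esub> s \<oplus>\<^bsub>L\<^esub> \<ominus>\<^bsub>L\<^esub> q = \<ominus>\<^bsub>L\<^esub> (q \<oplus>\<^bsub>L\<^esub> s)" using cl by (simp add: M.minus_add M.a_comm)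
  ultimately have "p = q \<oplus>\<^bsub>L\<^esub> s" using cl M.minus_equality[of p "\<ominus>\<^bsub>L\<^esub> (q \<oplus>\<^bsub>L\<^esub> s)"] by simp
  then show ?thesis by (simp add: p_def q_def s_def)
qed

lemma lie_eval_closed:
  assumes "\<And>x. x \<in> V \<Longrightarrow> g x \<in> carrier L" "set (word t) \<subseteq> V"
  shows "lie_eval L g t \<in> carrier L"
  using assms(2) by (induction t) (auto simp: assms(1) prod_closed)

lemma lie_eval_commute_letter:
  assumes "\<And>x. x \<in> set (word t) \<Longrightarrow> g x \<in> carrier L" "z \<in> carrier L"
    and "\<And>x. x \<in> set (word t) \<Longrightarrow> g x \<otimes>\<^bsub>L\<^esub> z = \<zero>\<^bsub>L\<^esub>"
  shows "lie_eval L g t \<otimes>\<^bsub>L\<^esub> z = \<zero>\<^bsub>L\<^esub>"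
  using assms(1,3)
proof (induction t)
  case (Br s t)
  have "lie_eval L g s \<in> carrier L" "lie_eval L g t \<in> carrier L"
    using lie_eval_closed[of "set (word (Br s t))" g] Br.prems(1) by auto
  then show ?case using Br leibniz[of "lie_eval L g s" "lie_eval L g t" z] assms(2) by simp
qed simp

end

section \<open>Rewriting products of basis words\<close>

text \<open>
  The position of a word among the words over \<open>V\<close> of its length. It turns the order, which is not
  well-founded on all words, into a measure for induction.
\<close>

definition word_rank :: "'x::linorder set \<Rightarrow> 'x list \<Rightarrow> nat" where
  "word_rank V c = card {w. set w \<subseteq> V \<and> length w = length c \<and> word_less w c}"

lemma word_rank_less:
  assumes "finite V" "set c \<subseteq> V" "length c = length d" "word_less c d"
  shows "word_rank V c < word_rank V d"
  unfolding word_rank_def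
proof (rule psubset_card_mono)
  show "finite {w. set w \<subseteq> V \<and> length w = length d \<and> word_less w d}"
    by (rule finite_subset[OF _ finite_lists_length_eq[OF assms(1), of "length d"]]) auto
  have "c \<in> {w. set w \<subseteq> V \<and> length w = length d \<and> word_less w d}" using assms by simp
  moreover have "c \<notin> {w. set w \<subseteq> V \<and> length w = length c \<and> word_less w c}" by simp
  moreover have "{w. set w \<subseteq> V \<and> length w = length c \<and> word_less w c} \<subseteq> {w. set w \<subseteq> V \<and> length w
      = length d \<and> word_less w d}"
    using assms word_less_trans by auto
  ultimately show "{w. set w \<subseteq> V \<and> length w = length c \<and> word_less w c} \<subset> {w. set w \<subseteq> V \<and> length w
      = length d \<and> word_less w d}"
    by blast
qed

lemma commuting_factor_append: "commuting_factor E u \<Longrightarrow> commuting_factor E (p @ u @ q)"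
  unfolding commuting_factor_def by (metis append.assoc append_Cons)

text \<open>
  The factor \<open>a x b\<close> meets both \<open>u\<close> and \<open>v\<close>. Since \<open>v\<close> begins with its greatest letter, its part
  of the factor is only \<open>b\<close>. If \<open>a x\<close> were a proper suffix of \<open>u\<close>, a prefix of it would be at most
  the right factor of \<open>u\<close>, hence at most \<open>v\<close>, although \<open>a\<close> is above the first letter \<open>b\<close> of \<open>v\<close>.
\<close>

lemma commuting_factor_across_boundary:
  fixes u v :: "'x::linorder naword"
  assumes u: "nonassoc_LS u" "\<not> commuting_factor E (word u)"
    and v: "nonassoc_LS v" "\<not> commuting_factor E (word v)"
    and fit: "\<And>s1 s2. u = Br s1 s2 \<Longrightarrow> word_le (word s2) (word v)"
    and f: "commuting_factor E (word u @ word v)"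
  obtains a x b z where "word u = a # x" "word v = b # z" "b < a" "\<forall>y\<in>set x. y < b"
      "\<forall>y\<in>set (a # x). {b, y} \<in> E"
proof -
  from f obtain p a x b q where f: "word u @ word v = p @ (a # x) @ b # q" "b < a" "\<forall>y\<in>set x. y < b"
      "\<forall>y\<in>set (a # x). {b, y} \<in> E"
    unfolding commuting_factor_def by blast
  have bad: "commuting_factor E ((a # x) @ [b])" unfolding commuting_factor_def using f(2-4)
    by (intro exI[of _ "[]"] exI[of _ a] exI[of _ x] exI[of _ b]) auto
  have no_u: "word u \<noteq> p @ ((a # x) @ [b]) @ s" for s using u(2) commuting_factor_append[OF bad]
    by auto
  have no_v: "word v \<noteq> s @ ((a # x) @ [b]) @ q" for s using v(2) commuting_factor_append[OF bad]
    by auto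
  have "\<exists>s. word u = p @ s \<and> s @ word v = (a # x) @ b # q"
    using f(1) no_v unfolding append_eq_append_conv2[of "word u"] by auto
  then obtain s where s: "word u = p @ s" "s @ word v = (a # x) @ b # q" by blast
  have "\<exists>t. a # x = s @ t \<and> t @ b # q = word v"
  proof -
    from s(2) consider t where "s = (a # x) @ t" "t @ word v = b # q" | t where "s @ t = a # x"
        "word v = t @ b # q"
      unfolding append_eq_append_conv2[of s] by blast
    then show ?thesis
    proof cases
      case 1
      then have "t = []" using no_u[of "tl t"] s(1) by (cases t) auto
      then show ?thesis using 1 by auto
    next
      case 2 then show ?thesis by (intro exI[of _ t]) auto
    qed
  qed
  then obtain t where t: "a # x = s @ t" "t @ b # q = word v" by blast
  have "s \<noteq> []" using t no_v[of "[]"] by auto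
  then obtain s' where s': "s = a # s'" "x = s' @ t" using t(1) by (cases s) auto
  have "t = []"
  proof (rule ccontr)
    assume "t \<noteq> []"
    then obtain e r where e: "t = e # r" by (cases t) auto
    have "b \<le> e" using assoc_LS_letter_le_hd[of e "r @ b # q" b]
        nonassoc_LS_imp_assoc_LS[OF v(1)] t(2) e by simp
    then show False using f(3) s' e by auto
  qed
  then have wv: "word v = b # q" and wu: "word u = p @ (a # x)" using t s by auto
  have "p = []"
  proof (rule ccontr)
    assume p: "p \<noteq> []"
    then obtain s1 s2 where Br: "u = Br s1 s2" using wu
      by (cases u) (auto simp: Cons_eq_append_conv)
    then obtain w r where w: "a # x = w @ r" "w \<noteq> []" "word_le w (word s2)"
      using nonassoc_LS_suffix_prefix[of s1 s2 p "a # x"] u(1) wu p by auto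
    then have "word_le w (b # q)" using fit[OF Br] wv word_le_trans by auto
    then show False using w(1,2) f(2) by (cases w) (auto simp: word_le_def)
  qed
  then show ?thesis using that wu wv f by auto
qed

locale commuting_generators = lie_algebra R L
  for R :: "('r, 'm) ring_scheme" (structure) and L :: "('r, 'a) module" (structure) +
  fixes V :: "'x::linorder set" and E :: "'x set set" and g :: "'x \<Rightarrow> 'a"
  assumes fin: "finite V" and loopfree: "\<And>x. {x, x} \<notin> E"
    and gen_closed: "\<And>x. x \<in> V \<Longrightarrow> g x \<in> carrier L"
    and gen_commute: "\<And>x y. {x, y} \<in> E \<Longrightarrow> g x \<otimes>\<^bsub>L\<^esub> g y = \<zero>\<^bsub>L\<^esub>"
begin

abbreviation ev :: "'x naword \<Rightarrow> 'a" where "ev \<equiv> lie_eval L g"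

definition normal_words :: "'x naword set" where
  "normal_words = {t. set (word t) \<subseteq> V \<and> nonassoc_LS t \<and> \<not> commuting_factor E (word t)}"

definition evals_upto :: "'x list \<Rightarrow> 'a set" where
  "evals_upto c = ev ` {t \<in> normal_words. length (word t) = length c \<and> word_le (word t) c}"

lemma ev_closed: "t \<in> normal_words \<Longrightarrow> ev t \<in> carrier L"
  using lie_eval_closed[of V g t] gen_closed by (auto simp: normal_words_def)

lemma evals_upto_closed: "evals_upto c \<subseteq> carrier L"
  unfolding evals_upto_def using ev_closed by auto

lemma evals_upto_mono: "length c = length d \<Longrightarrow> word_le c d \<Longrightarrow> evals_upto c \<subseteq> evals_upto d"
  unfolding evals_upto_def using word_le_trans by fastforce

lemma ev_in_span: "t \<in> normal_words \<Longrightarrow> length (word t) = length c \<Longrightarrow> word_le (word t) c \<Longrightarrow>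
    ev t \<in> lin_span R L (evals_upto c)"
  by (rule lin_span_base[OF evals_upto_closed]) (auto simp: evals_upto_def)

lemma prod_evals_upto_left:
  assumes "x \<in> lin_span R L (evals_upto c)" "y \<in> carrier L"
    and "\<And>t. t \<in> normal_words \<Longrightarrow> length (word t) = length c \<Longrightarrow> word_le (word t) c \<Longrightarrow>
        ev t \<otimes>\<^bsub>L\<^esub> y \<in> lin_span R L (evals_upto d)"
  shows "x \<otimes>\<^bsub>L\<^esub> y \<in> lin_span R L (evals_upto d)"
  by (rule prod_lin_span_left[OF evals_upto_closed evals_upto_closed assms(1,2)])
    (use assms(3) in \<open>auto simp: evals_upto_def\<close>)

lemma prod_evals_upto_right:
  assumes "x \<in> lin_span R L (evals_upto c)" "y \<in> carrier L"
    and "\<And>t. t \<in> normal_words \<Longrightarrow> length (word t) = length c \<Longrightarrow> word_le (word t) c \<Longrightarrow>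
        y \<otimes>\<^bsub>L\<^esub> ev t \<in> lin_span R L (evals_upto d)"
  shows "y \<otimes>\<^bsub>L\<^esub> x \<in> lin_span R L (evals_upto d)"
  by (rule prod_lin_span_right[OF evals_upto_closed evals_upto_closed assms(1,2)])
    (use assms(3) in \<open>auto simp: evals_upto_def\<close>)

lemma normal_words_Br: "Br s t \<in> normal_words \<Longrightarrow> s \<in> normal_words \<and> t \<in> normal_words"
  unfolding normal_words_def using commuting_factor_append[of E "word s" "[]" "word t"]
      commuting_factor_append[of E "word t" "word s" "[]"]
  by (auto simp: nonassoc_LS_Br)

lemma nonassoc_LS_swap:
  assumes "nonassoc_LS s" "nonassoc_LS t" "word_less (word t) (word s)"
  shows "word_less (word t @ word s) (word s @ word t)"
  using assoc_LS_append[OF nonassoc_LS_imp_assoc_LS[OF assms(1)] nonassoc_LS_imp_assoc_LS[OF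
      assms(2)] assms(3)]
  by (auto simp: assoc_LS_def)

text \<open>
  Rewriting a product never enlarges its leading word \<open>u v\<close>. The well-founded measure consists of
  the length of \<open>u v\<close>, its rank among the words of this length, and the length of \<open>u\<close>, compared
  lexicographically. The last component serves the one case in which the leading word stays the
  same.
\<close>

lemma prod_in_span:
  assumes "u \<in> normal_words" "v \<in> normal_words" "word_less (word v) (word u)"
  shows "ev u \<otimes>\<^bsub>L\<^esub> ev v \<in> lin_span R L (evals_upto (word u @ word v))"
proof -
  define m where "m
      = measures [\<lambda>(u, v). length (word u @ word v), \<lambda>(u, v). word_rank V (word u @ word v),
     \<lambda>(u :: 'x naword, v :: 'x naword). length (word u)]"
  have "wf m" unfolding m_def by simp
  then have "\<forall>u v. p = (u, v) \<longrightarrow> u \<in> normal_words \<longrightarrow> v \<in> normal_words \<longrightarrow> word_less (word v) (word u) \<longrightarrow>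
     ev u \<otimes>\<^bsub>L\<^esub> ev v \<in> lin_span R L (evals_upto (word u @ word v))" for p
  proof (induction p rule: wf_induct_rule)
    case (less p)
    show ?case
    proof (intro allI impI)
      fix u v assume p: "p = (u, v)" and u: "u \<in> normal_words" and v: "v \<in> normal_words"
        and vu: "word_less (word v) (word u)"
      define c where "c = word u @ word v"
      have IH: "ev s \<otimes>\<^bsub>L\<^esub> ev t \<in> lin_span R L (evals_upto (word s @ word t))"
        if "s \<in> normal_words" "t \<in> normal_words" "word_less (word t) (word s)"
            "((s, t), (u, v)) \<in> m" for s t
        using less[of "(s, t)"] that p by blast
      have LS: "nonassoc_LS u" "nonassoc_LS v" and cV: "set c \<subseteq> V"
        using u v by (auto simp: normal_words_def c_def)
      have LSc: "assoc_LS c" unfolding c_def using LS vu assoc_LS_append nonassoc_LS_imp_assoc_LS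
        by blast
      note closed = ev_closed[OF u] ev_closed[OF v]
      note sets = evals_upto_closed
      have shorter: "ev s \<otimes>\<^bsub>L\<^esub> ev t \<in> lin_span R L (evals_upto (word s @ word t))"
        if "s \<in> normal_words" "t \<in> normal_words" "word_less (word t) (word s)"
          "length (word s @ word t) < length c" for s t
        using IH[OF that(1-3)] that(4) by (simp add: m_def c_def)
      have smaller1: "ev s \<otimes>\<^bsub>L\<^esub> ev t \<in> lin_span R L (evals_upto c)"
        if st: "s \<in> normal_words" "t \<in> normal_words" "word_less (word t) (word s)"
          "length (word s @ word t) = length c" "word_less (word s @ word t) c" for s t
      proof -
        have "set (word s @ word t) \<subseteq> V" using st by (auto simp: normal_words_def)
        then have "word_rank V (word s @ word t) < word_rank V c"
          using word_rank_less[OF fin _ st(4,5)] by blast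
        then have "((s, t), (u, v)) \<in> m" using st(4) by (simp add: m_def c_def)
        then have "ev s \<otimes>\<^bsub>L\<^esub> ev t \<in> lin_span R L (evals_upto (word s @ word t))" using IH st by blast
        then show ?thesis using lin_span_mono[OF evals_upto_mono[OF st(4)]] st(5)
          by (auto simp: word_le_def)
      qed
      \<comment> \<open>The factors need not be ordered here, so both concatenations have to lie below \<open>c\<close>.\<close>
      have smaller: "ev s \<otimes>\<^bsub>L\<^esub> ev t \<in> lin_span R L (evals_upto c)"
        if st: "s \<in> normal_words" "t \<in> normal_words" "length (word s @ word t) = length c"
          "word_less (word s @ word t) c" "word_less (word t @ word s) c" for s t
      proof -
        consider "word_less (word t) (word s)" | "word s = word t" | "word_less (word s) (word t)"
          using word_less_linear by blast
        then show ?thesis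
        proof cases
          case 2
          then have "s = t" using st nonassoc_LS_unique by (auto simp: normal_words_def)
          then show ?thesis using alternating ev_closed[OF st(1)] lin_span.zero by simp
        next
          case 3
          then have "ev t \<otimes>\<^bsub>L\<^esub> ev s \<in> lin_span R L (evals_upto c)" using smaller1[OF st(2,1)] st
            by simp
          then show ?thesis
            using anticommute[of "ev s" "ev t"] ev_closed st lin_span_uminus[OF sets] by simp
        qed (use st smaller1 in blast)
      qed
      have "ev u \<otimes>\<^bsub>L\<^esub> ev v \<in> lin_span R L (evals_upto c)"
      proof (cases "\<exists>u1 u2. u = Br u1 u2 \<and> word_less (word v) (word u2)")
        case True
        then obtain u1 u2 where u12: "u = Br u1 u2" "word_less (word v) (word u2)" by blast
        note n = conjunct1[OF normal_words_Br[OF u[unfolded u12(1)]]]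
            conjunct2[OF normal_words_Br[OF u[unfolded u12(1)]]]
        note cl = ev_closed[OF n(1)] ev_closed[OF n(2)]
        have LS12: "nonassoc_LS u1" "nonassoc_LS u2" "word_less (word u2) (word u1)"
          using LS(1) u12(1) by (auto simp: nonassoc_LS_Br)
        have vu1: "word_less (word v) (word u1)" using u12(2) LS12(3) word_less_trans by blast
        have c: "c = word u1 @ word u2 @ word v" using c_def u12(1) by simp
        have u2u1: "word_less (word u2 @ word u1 @ word v) c"
          using word_less_append_right[OF _ nonassoc_LS_swap[OF LS12], of "word v" "word v"] c
            by simp
        have u1v: "ev u1 \<otimes>\<^bsub>L\<^esub> ev v \<in> lin_span R L (evals_upto (word u1 @ word v))"
          by (rule shorter[OF n(1) v vu1]) (simp add: c)
        have first: "(ev u1 \<otimes>\<^bsub>L\<^esub> ev v) \<otimes>\<^bsub>L\<^esub> ev u2 \<in> lin_span R L (evals_upto c)"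
        proof (rule prod_evals_upto_left[OF u1v cl(2)])
          fix t assume t: "t \<in> normal_words" "length (word t) = length (word u1 @ word v)"
              "word_le (word t) (word u1 @ word v)"
          show "ev t \<otimes>\<^bsub>L\<^esub> ev u2 \<in> lin_span R L (evals_upto c)"
          proof (rule smaller[OF t(1) n(2)])
            show "length (word t @ word u2) = length c" using t(2) c by simp
            have "word_le (word t @ word u2) (word u1 @ word v @ word u2)"
              using word_le_append_right[OF t(2,3), of "word u2"] by simp
            moreover have "word_less (word u1 @ word v @ word u2) c"
              using nonassoc_LS_swap[OF LS12(2) LS(2) u12(2)] c by simp
            ultimately show "word_less (word t @ word u2) c" using word_le_less_trans by blast
            show "word_less (word u2 @ word t) c"
              using t(3) u2u1 word_le_less_trans[of _ "word u2 @ word u1 @ word v"] by simp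
          qed
        qed
        have u2v: "ev u2 \<otimes>\<^bsub>L\<^esub> ev v \<in> lin_span R L (evals_upto (word u2 @ word v))"
          by (rule shorter[OF n(2) v u12(2)]) (simp add: c)
        \<comment> \<open>In this product the leading word may be all of \<open>c\<close>;
          then the left factor is \<open>u1\<close>, which is shorter than \<open>u\<close>.\<close>
        have second: "ev u1 \<otimes>\<^bsub>L\<^esub> (ev u2 \<otimes>\<^bsub>L\<^esub> ev v) \<in> lin_span R L (evals_upto c)"
        proof (rule prod_evals_upto_right[OF u2v cl(1)])
          fix t assume t: "t \<in> normal_words" "length (word t) = length (word u2 @ word v)"
              "word_le (word t) (word u2 @ word v)"
          have len: "length (word u1 @ word t) = length c" using t(2) c by simp
          show "ev u1 \<otimes>\<^bsub>L\<^esub> ev t \<in> lin_span R L (evals_upto c)"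
          proof (cases "word t = word u2 @ word v")
            case True
            have "sless (word t) c" using assoc_LS_suffix[OF LSc, of "word u1" "word t"] c True
              by simp
            moreover have "word_less c (word u1)"
              using word_less_append_prefix[of "word u2 @ word v" "word u1"] c by simp
            ultimately have "word_less (word t) (word u1)" using sless_imp_word_less word_less_trans
              by blast
            moreover have "((u1, t), (u, v)) \<in> m" using True u12(1) by (simp add: m_def)
            ultimately have "ev u1 \<otimes>\<^bsub>L\<^esub> ev t \<in> lin_span R L (evals_upto (word u1 @ word t))"
              using IH n(1) t(1) by blast
            then show ?thesis using True c by simp
          next
            case False
            then have lt: "word_less (word t) (word u2 @ word v)" using t(3)
              by (auto simp: word_le_def)
            show ?thesis
            proof (rule smaller[OF n(1) t(1) len])
              show "word_less (word u1 @ word t) c" using lt c by simp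
              have "word_le (word t @ word u1) ((word u2 @ word v) @ word u1)"
                by (rule word_le_append_right[OF t(2,3)])
              moreover have "word_less ((word u2 @ word v) @ word u1) c" using LSc c
                unfolding assoc_LS_def
                by (metis append_is_Nil_conv word_ne(1))
              ultimately show "word_less (word t @ word u1) c" using word_le_less_trans by blast
            qed
          qed
        qed
        show ?thesis using leibniz[OF cl closed(2)] lin_span_add[OF sets first second] u12(1)
          by simp
      next
        case False
        then have fit: "\<And>s1 s2. u = Br s1 s2 \<Longrightarrow> word_le (word s2) (word v)" using not_word_less
          by blast
        then have LSuv: "nonassoc_LS (Br u v)" using LS vu by (simp add: nonassoc_LS_Br)
        show ?thesis
        proof (cases "commuting_factor E c")
          case False
          then have "Br u v \<in> normal_words" using LSuv cV by (simp add: normal_words_def c_def)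
          then show ?thesis using ev_in_span[of "Br u v" c] by (simp add: c_def)
        next
          case True
          have nf: "\<not> commuting_factor E (word u)" "\<not> commuting_factor E (word v)"
            using u v by (simp_all add: normal_words_def)
          obtain a x b z where f: "word u = a # x" "word v = b # z" "b < a" "\<forall>y\<in>set x. y < b"
              "\<forall>y\<in>set (a # x). {b, y} \<in> E"
            by (rule commuting_factor_across_boundary[OF LS(1) nf(1) LS(2) nf(2) fit True[unfolded
                c_def]])
          have uV: "set (word u) \<subseteq> V" "set (word v) \<subseteq> V" using u v by (auto simp: normal_words_def)
          show ?thesis
          proof (cases v)
            case (Letter b')
            then have "b' = b" using f by simp
            moreover have "ev u \<otimes>\<^bsub>L\<^esub> g b = \<zero>\<^bsub>L\<^esub>"
            proof (rule lie_eval_commute_letter)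
              show "g b \<in> carrier L" using gen_closed uV f(2) by simp
              fix y assume y: "y \<in> set (word u)"
              then show "g y \<in> carrier L" using gen_closed uV by blast
              have "{y, b} \<in> E" using y f(1,5) by (metis insert_commute)
              then show "g y \<otimes>\<^bsub>L\<^esub> g b = \<zero>\<^bsub>L\<^esub>" by (rule gen_commute)
            qed
            ultimately have "ev u \<otimes>\<^bsub>L\<^esub> ev v = \<zero>\<^bsub>L\<^esub>" using Letter by simp
            then show ?thesis by (simp add: lin_span.zero)
          next
            case (Br v1 v2)
            note n = conjunct1[OF normal_words_Br[OF v[unfolded Br]]]
                conjunct2[OF normal_words_Br[OF v[unfolded Br]]]
            note cl = ev_closed[OF n(1)] ev_closed[OF n(2)]
            have LS12: "nonassoc_LS v1" "nonassoc_LS v2" "word_less (word v2) (word v1)"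
              using LS(2) Br by (auto simp: nonassoc_LS_Br)
            have c: "c = word u @ word v1 @ word v2" using c_def Br by simp
            obtain z1 where z1: "word v1 = b # z1" using word_ne(1)[of v1] f(2) Br
              by (cases "word v1") auto
            obtain e z2 where z2: "word v2 = e # z2" using word_ne(1)[of v2]
              by (cases "word v2") auto
            have "e \<le> b" using LS12(3) z1 z2 by auto
            then have v2u: "word_less (word v2) (word u)" and v1u: "word_less (word v1) (word u)"
              using z1 z2 f(1,3) by auto
            have uv1: "ev u \<otimes>\<^bsub>L\<^esub> ev v1 \<in> lin_span R L (evals_upto (word u @ word v1))"
              by (rule shorter[OF u n(1) v1u]) (simp add: c)
            have uv2: "ev u \<otimes>\<^bsub>L\<^esub> ev v2 \<in> lin_span R L (evals_upto (word u @ word v2))"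
              by (rule shorter[OF u n(2) v2u]) (simp add: c)
            \<comment> \<open>The word \<open>u v1\<close> still contains the forbidden factor,
              so only smaller words occur in \<open>(u, v1)\<close>.\<close>
            have bad: "commuting_factor E (word u @ word v1)"
              unfolding commuting_factor_def using f z1
                by (intro exI[of _ "[]"] exI[of _ a] exI[of _ x] exI[of _ b] exI[of _ z1]) auto
            have first: "(ev u \<otimes>\<^bsub>L\<^esub> ev v1) \<otimes>\<^bsub>L\<^esub> ev v2 \<in> lin_span R L (evals_upto c)"
            proof (rule prod_evals_upto_left[OF uv1 cl(2)])
              fix t assume t: "t \<in> normal_words" "length (word t) = length (word u @ word v1)"
                  "word_le (word t) (word u @ word v1)"
              have "word t \<noteq> word u @ word v1" using t(1) bad by (auto simp: normal_words_def)
              then have lt: "word_less (word t) (word u @ word v1)" using t(3)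
                by (simp add: word_le_def)
              show "ev t \<otimes>\<^bsub>L\<^esub> ev v2 \<in> lin_span R L (evals_upto c)"
              proof (rule smaller[OF t(1) n(2)])
                show "length (word t @ word v2) = length c" using t(2) c by simp
                show "word_less (word t @ word v2) c" using word_less_append_right[OF t(2) lt] c
                  by simp
                have "word_less (word v2 @ word u @ word v1) c" using LSc c unfolding assoc_LS_def
                  by (metis append.assoc append_is_Nil_conv word_ne(1))
                then show "word_less (word v2 @ word t) c"
                  using t(3) word_le_less_trans[of _ "word v2 @ word u @ word v1"] by simp
              qed
            qed
            have second: "(ev u \<otimes>\<^bsub>L\<^esub> ev v2) \<otimes>\<^bsub>L\<^esub> ev v1 \<in> lin_span R L (evals_upto c)"
            proof (rule prod_evals_upto_left[OF uv2 cl(1)])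
              fix t assume t: "t \<in> normal_words" "length (word t) = length (word u @ word v2)"
                  "word_le (word t) (word u @ word v2)"
              show "ev t \<otimes>\<^bsub>L\<^esub> ev v1 \<in> lin_span R L (evals_upto c)"
              proof (rule smaller[OF t(1) n(1)])
                show "length (word t @ word v1) = length c" using t(2) c by simp
                have "word_le (word t @ word v1) ((word u @ word v2) @ word v1)"
                  by (rule word_le_append_right[OF t(2,3)])
                moreover have "word_less ((word u @ word v2) @ word v1) c"
                  using nonassoc_LS_swap[OF LS12] c by simp
                ultimately show "word_less (word t @ word v1) c" using word_le_less_trans by blast
                show "word_less (word v1 @ word t) c" using z1 f(1,3) c by simp
              qed
            qed
            have "ev u \<otimes>\<^bsub>L\<^esub> (ev v1 \<otimes>\<^bsub>L\<^esub> ev v2)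
                = \<ominus>\<^bsub>L\<^esub> ((ev u \<otimes>\<^bsub>L\<^esub> ev v2) \<otimes>\<^bsub>L\<^esub> ev v1) \<oplus>\<^bsub>L\<^esub> (ev u \<otimes>\<^bsub>L\<^esub> ev v1) \<otimes>\<^bsub>L\<^esub> ev v2"
              using leibniz[OF closed(1) cl] closed cl by (simp add: prod_closed M.r_neg1)
            then show ?thesis using lin_span_add[OF sets lin_span_uminus[OF sets second] first] Br
              by simp
          qed
        qed
      qed
      then show "ev u \<otimes>\<^bsub>L\<^esub> ev v \<in> lin_span R L (evals_upto (word u @ word v))" by (simp add: c_def)
    qed
  qed
  then show ?thesis using assms by blast
qed

lemma ev_in_lin_span:
  assumes "set (word t) \<subseteq> V" shows "ev t \<in> lin_span R L (ev ` normal_words)"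
proof -
  let ?S = "lin_span R L (ev ` normal_words)"
  have cl: "ev ` normal_words \<subseteq> carrier L" using ev_closed by auto
  have base: "ev u \<otimes>\<^bsub>L\<^esub> ev v \<in> ?S"
      if uv: "u \<in> normal_words" "v \<in> normal_words" "word_less (word v) (word u)" for u v
    using prod_in_span[OF uv] lin_span_mono[of "evals_upto (word u @ word v)" "ev ` normal_words"]
    by (auto simp: evals_upto_def)
  have base': "ev u \<otimes>\<^bsub>L\<^esub> ev v \<in> ?S" if uv: "u \<in> normal_words" "v \<in> normal_words" for u v
  proof -
    consider "word_less (word v) (word u)" | "word u = word v" | "word_less (word u) (word v)"
      using word_less_linear by blast
    then show ?thesis
    proof cases
      case 2
      then have "u = v" using uv nonassoc_LS_unique by (auto simp: normal_words_def)
      then show ?thesis using alternating ev_closed uv lin_span.zero by simp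
    next
      case 3
      then show ?thesis using base[OF uv(2,1)]
          anticommute[of "ev u" "ev v"] ev_closed uv lin_span_uminus[OF cl] by simp
    qed (use base uv in blast)
  qed
  show ?thesis using assms
  proof (induction t)
    case (Letter x)
    have "Letter x \<in> normal_words" using Letter
      by (auto simp: normal_words_def commuting_factor_def Cons_eq_append_conv)
    then show ?case using lin_span_base[OF cl] by blast
  next
    case (Br s t)
    then have st: "ev s \<in> ?S" "ev t \<in> ?S" by auto
    have tc: "ev t \<in> carrier L" using st lin_span_closed[OF cl] by blast
    have "b \<otimes>\<^bsub>L\<^esub> ev t \<in> ?S" if "b \<in> ev ` normal_words" for b
      by (rule prod_lin_span_right[OF cl cl st(2)]) (use that base' ev_closed in auto)
    then show ?case using prod_lin_span_left[OF cl cl st(1) tc] by simp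
  qed
qed

end

section \<open>An action of the free algebra on functions of words\<close>

text \<open>
  A word \<open>v\<close> acts on a function \<open>\<phi>\<close> of words by \<open>w \<mapsto> \<phi> (v w)\<close>. Acting by \<open>s\<close> first and by \<open>t\<close>
  afterwards is the action of the word \<open>s t\<close>, which explains the order of the two composites in the
  commutator. The value of \<open>word_action R t \<phi>\<close> at the empty word is the pairing of \<open>\<phi>\<close> with the
  expansion of the bracketing \<open>t\<close> in associative words.
\<close>

primrec word_action :: "('r, 'm) ring_scheme \<Rightarrow> 'x naword \<Rightarrow> ('x list \<Rightarrow> 'r) \<Rightarrow> 'x list \<Rightarrow> 'r" where
  "word_action R (Letter x) = (\<lambda>\<phi> w. \<phi> (x # w))"
| "word_action R (Br s t)
    = (\<lambda>\<phi> w. word_action R t (word_action R s \<phi>) w \<ominus>\<^bsub>R\<^esub> word_action R s (word_action R t \<phi>) w)"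

text \<open>
  The linear extension of \<open>word_action\<close> to formal combinations of bracketings.
\<close>

definition lin_action ::
    "('r, 'm) ring_scheme \<Rightarrow> ('x naword \<Rightarrow> 'r) \<Rightarrow> ('x list \<Rightarrow> 'r) \<Rightarrow> 'x list \<Rightarrow> 'r" where
  "lin_action R f \<phi> w = (\<Oplus>\<^bsub>R\<^esub>t\<in>{t. f t \<noteq> \<zero>\<^bsub>R\<^esub>}. f t \<otimes>\<^bsub>R\<^esub> word_action R t \<phi> w)"

definition monomial :: "('r, 'm) ring_scheme \<Rightarrow> 'x naword \<Rightarrow> 'x naword \<Rightarrow> 'r" where
  "monomial R t = (\<lambda>s. if s = t then \<one>\<^bsub>R\<^esub> else \<zero>\<^bsub>R\<^esub>)"

definition trace_invariant :: "('r, 'm) ring_scheme \<Rightarrow> 'x set set \<Rightarrow> ('x list \<Rightarrow> 'r) \<Rightarrow> bool" where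
  "trace_invariant R E \<phi> \<longleftrightarrow> (\<forall>w. \<phi> w \<in> carrier R) \<and> (\<forall>u v. trace_eq E u v \<longrightarrow> \<phi> u = \<phi> v)"

context cring
begin

lemma word_action_closed:
  assumes "\<And>w. \<phi> w \<in> carrier R" shows "word_action R t \<phi> w \<in> carrier R"
  using assms by (induction t arbitrary: \<phi> w) auto

lemma word_action_zero: "word_action R t (\<lambda>w. \<zero>) w = \<zero>"
proof (induction t arbitrary: w)
  case (Br s t)
  have "word_action R s (\<lambda>w. \<zero>) = (\<lambda>w. \<zero>)" "word_action R t (\<lambda>w. \<zero>) = (\<lambda>w. \<zero>)" using Br by auto
  then show ?case by (simp add: minus_eq)
qed simp

lemma word_action_linear:
  assumes "r \<in> carrier R" "\<And>w. \<phi> w \<in> carrier R" "\<And>w. \<psi> w \<in> carrier R"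
  shows "word_action R t (\<lambda>w. r \<otimes> \<phi> w \<oplus> \<psi> w) w = r \<otimes> word_action R t \<phi> w \<oplus> word_action R t \<psi> w"
  using assms(2,3)
proof (induction t arbitrary: \<phi> \<psi> w)
  case (Br s t)
  note c = word_action_closed[of \<phi>, OF Br.prems(1)] word_action_closed[of \<psi>, OF Br.prems(2)]
  note c2 = word_action_closed[of "word_action R s \<phi>", OF c(1)]
      word_action_closed[of "word_action R s \<psi>", OF c(2)]
    word_action_closed[of "word_action R t \<phi>", OF c(1)]
        word_action_closed[of "word_action R t \<psi>", OF c(2)]
  have "word_action R s (\<lambda>w. r \<otimes> \<phi> w \<oplus> \<psi> w) = (\<lambda>w. r \<otimes> word_action R s \<phi> w \<oplus> word_action R s \<psi> w)"
    "word_action R t (\<lambda>w. r \<otimes> \<phi> w \<oplus> \<psi> w) = (\<lambda>w. r \<otimes> word_action R t \<phi> w \<oplus> word_action R t \<psi> w)"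
    using Br.IH Br.prems by (simp_all add: fun_eq_iff)
  then have "word_action R (Br s t) (\<lambda>w. r \<otimes> \<phi> w \<oplus> \<psi> w) w =
      (r \<otimes> word_action R t (word_action R s \<phi>) w \<oplus> word_action R t (word_action R s \<psi>) w) \<ominus>
      (r \<otimes> word_action R s (word_action R t \<phi>) w \<oplus> word_action R s (word_action R t \<psi>) w)"
    using Br.IH c by simp
  also have "\<dots> = r \<otimes> (word_action R t (word_action R s \<phi>) w
      \<ominus> word_action R s (word_action R t \<phi>) w) \<oplus>
      (word_action R t (word_action R s \<psi>) w \<ominus> word_action R s (word_action R t \<psi>) w)"
    using assms(1) c2[of _ w] by algebra
  finally show ?case by simp
qed simp

lemma word_action_trace_invariant:
  "trace_invariant R E \<phi> \<Longrightarrow> trace_invariant R E (word_action R t \<phi>)"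
proof (induction t arbitrary: \<phi>)
  case (Letter x)
  have "trace_eq E (x # u) (x # v)" if "trace_eq E u v" for u v
    using that trace_eq_append_left[of E "[x]"] by simp
  then show ?case using Letter unfolding trace_invariant_def by auto
next
  case (Br s t)
  have "trace_invariant R E (word_action R t (word_action R s \<phi>))"
      "trace_invariant R E (word_action R s (word_action R t \<phi>))"
    using Br by blast+
  then show ?case unfolding trace_invariant_def by auto
qed

text \<open>
  In the expansion of \<open>(s, t)\<close> the product \<open>s t\<close> contributes its leading word, and all words of the
  product \<open>t s\<close> are at most \<open>word t @ word s\<close>, which is smaller by the Lyndon--Shirshov condition.
\<close>

lemma word_action_leading:
  assumes "nonassoc_LS t" "\<And>w. \<phi> w \<in> carrier R"
    and "\<And>v. length v = length (word t) \<Longrightarrow> word_less v (word t) \<Longrightarrow> \<phi> (v @ w) = \<zero>"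
  shows "word_action R t \<phi> w = \<phi> (word t @ w)"
  using assms
proof (induction t arbitrary: \<phi> w)
  case (Br s t)
  let ?s = "word s" and ?t = "word t"
  note c = word_action_closed[of \<phi>, OF Br.prems(2)]
  have LS: "nonassoc_LS s" "nonassoc_LS t" "word_less ?t ?s" using Br.prems(1)
    by (auto simp: nonassoc_LS_Br)
  have swap: "word_less (?t @ ?s) (?s @ ?t)"
    using nonassoc_LS_imp_assoc_LS[OF Br.prems(1)] by (auto simp: assoc_LS_def)
  have zero: "\<phi> (u @ v @ w) = \<zero>"
      if "length (u @ v) = length (?s @ ?t)" "word_less (u @ v) (?s @ ?t)" for u v
    using Br.prems(3)[of "u @ v"] that by simp
  have s: "word_action R s \<phi> (v @ w) = \<phi> (?s @ v @ w)" if "length v = length ?t" for v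
  proof (rule Br.IH(1)[OF LS(1) Br.prems(2)])
    fix u assume "length u = length ?s" "word_less u ?s"
    then show "\<phi> (u @ v @ w) = \<zero>" using zero[of u v] word_less_append_right[of u ?s v ?t] that
      by simp
  qed
  have st: "word_action R t (word_action R s \<phi>) w = word_action R s \<phi> (?t @ w)"
  proof (rule Br.IH(2)[OF LS(2) c])
    fix v assume "length v = length ?t" "word_less v ?t"
    then show "word_action R s \<phi> (v @ w) = \<zero>" using s zero by simp
  qed
  have t: "word_action R t \<phi> (v @ w) = \<zero>" if v: "length v = length ?s" "word_le v ?s" for v
  proof -
    have le: "word_less (u @ v) (?s @ ?t)" if "length u = length ?t" "word_le u ?t" for u
      using word_le_append[OF that v(2)] swap word_le_less_trans by blast
    have "word_action R t \<phi> (v @ w) = \<phi> (?t @ v @ w)"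
      using Br.IH(2)[OF LS(2) Br.prems(2)] zero le v(1) by (auto simp: word_le_def)
    then show ?thesis using zero le[of ?t] v(1) by simp
  qed
  have "word_action R s (word_action R t \<phi>) w = word_action R t \<phi> (?s @ w)"
    by (rule Br.IH(1)[OF LS(1) c]) (use t in \<open>auto simp: word_le_def\<close>)
  then have "word_action R s (word_action R t \<phi>) w = \<zero>" using t by simp
  then show ?case using st s Br.prems(2) by (simp add: minus_eq)
qed simp

lemma free_nonassoc_carrierD:
  assumes "f \<in> carrier (free_nonassoc R V)" shows "f t \<in> carrier R" "finite {t. f t \<noteq> \<zero>}"
  using assms by (auto simp: free_nonassoc_def)

lemma monomial_closed:
  assumes "set (word t) \<subseteq> V" shows "monomial R t \<in> carrier (free_nonassoc R V)"
proof -
  have "{s. monomial R t s \<noteq> \<zero>} \<subseteq> {t}" by (auto simp: monomial_def)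
  then show ?thesis using assms by (auto simp: free_nonassoc_def monomial_def intro: finite_subset)
qed

lemma free_nonassoc_induct [consumes 1, case_names zero step]:
  assumes "f \<in> carrier (free_nonassoc R V)" and "P \<zero>\<^bsub>free_nonassoc R V\<^esub>"
    and step: "\<And>r t f. \<lbrakk>r \<in> carrier R; set (word t) \<subseteq> V; f \<in> carrier (free_nonassoc R V); P f\<rbrakk>
      \<Longrightarrow> P (r \<odot>\<^bsub>free_nonassoc R V\<^esub> monomial R t \<oplus>\<^bsub>free_nonassoc R V\<^esub> f)"
  shows "P f"
  using assms(1)
proof (induction "card {t. f t \<noteq> \<zero>}" arbitrary: f rule: less_induct)
  case less
  show ?case
  proof (cases "\<exists>t. f t \<noteq> \<zero>")
    case False
    then have "f = \<zero>\<^bsub>free_nonassoc R V\<^esub>" by (auto simp: free_nonassoc_def)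
    then show ?thesis using assms(2) by simp
  next
    case True
    then obtain t where t: "f t \<noteq> \<zero>" by blast
    define h where "h = f(t := \<zero>)"
    have fin: "finite {t. f t \<noteq> \<zero>}" and V: "set (word t) \<subseteq> V" and ft: "f t \<in> carrier R"
      using less.prems t by (auto simp: free_nonassoc_def)
    have sub: "{t. h t \<noteq> \<zero>} \<subset> {t. f t \<noteq> \<zero>}" using t by (auto simp: h_def)
    have h: "h \<in> carrier (free_nonassoc R V)"
      using less.prems finite_subset[OF _ fin] sub by (auto simp: free_nonassoc_def h_def)
    have "P h" using less.hyps[OF psubset_card_mono[OF fin sub] h] .
    moreover have "f = f t \<odot>\<^bsub>free_nonassoc R V\<^esub> monomial R t \<oplus>\<^bsub>free_nonassoc R V\<^esub> h"
      using less.prems by (auto simp: free_nonassoc_def monomial_def h_def)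
    ultimately show ?thesis using step[OF ft V h] by simp
  qed
qed

lemma lin_action_superset:
  assumes "finite S" "{t. f t \<noteq> \<zero>} \<subseteq> S" "\<And>t. f t \<in> carrier R" "\<And>w. \<phi> w \<in> carrier R"
  shows "lin_action R f \<phi> w = (\<Oplus>t\<in>S. f t \<otimes> word_action R t \<phi> w)"
  unfolding lin_action_def
  by (rule add.finprod_mono_neutral_cong_left) (use assms word_action_closed[of \<phi>] in auto)

lemma lin_action_closed:
  assumes "f \<in> carrier (free_nonassoc R V)" "\<And>w. \<phi> w \<in> carrier R"
  shows "lin_action R f \<phi> w \<in> carrier R"
  unfolding lin_action_def
  by (rule finsum_closed) (use free_nonassoc_carrierD[OF assms(1)]
      word_action_closed[of \<phi>] assms(2) in auto)

lemma lin_action_zero [simp]: "lin_action R (\<zero>\<^bsub>free_nonassoc R V\<^esub>) \<phi> w = \<zero>"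
  by (simp add: lin_action_def free_nonassoc_def)

lemma lin_action_monomial:
  assumes "\<And>w. \<phi> w \<in> carrier R"
  shows "lin_action R (monomial R t) \<phi> w = word_action R t \<phi> w"
proof -
  have "lin_action R (monomial R t) \<phi> w = (\<Oplus>s\<in>{t}. monomial R t s \<otimes> word_action R s \<phi> w)"
    by (rule lin_action_superset) (use assms in \<open>auto simp: monomial_def\<close>)
  then show ?thesis using word_action_closed[of \<phi>] assms by (simp add: monomial_def)
qed

lemma lin_action_linear_left:
  assumes "r \<in> carrier R" "f \<in> carrier (free_nonassoc R V)" "h \<in> carrier (free_nonassoc R V)"
    and "\<And>w. \<phi> w \<in> carrier R"
  shows "lin_action R (r \<odot>\<^bsub>free_nonassoc R V\<^esub> f \<oplus>\<^bsub>free_nonassoc R V\<^esub> h) \<phi> w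
    = r \<otimes> lin_action R f \<phi> w \<oplus> lin_action R h \<phi> w"
proof -
  let ?S = "{t. f t \<noteq> \<zero>} \<union> {t. h t \<noteq> \<zero>}" and ?a = "\<lambda>t. word_action R t \<phi> w"
  note fc = free_nonassoc_carrierD[OF assms(2)] and hc = free_nonassoc_carrierD[OF assms(3)]
  have ac: "?a t \<in> carrier R" for t using word_action_closed assms(4) by blast
  have fin: "finite ?S" using fc hc by simp
  have e: "(r \<odot>\<^bsub>free_nonassoc R V\<^esub> f \<oplus>\<^bsub>free_nonassoc R V\<^esub> h) = (\<lambda>t. r \<otimes> f t \<oplus> h t)"
    by (simp add: free_nonassoc_def)
  have "lin_action R (\<lambda>t. r \<otimes> f t \<oplus> h t) \<phi> w = (\<Oplus>t\<in>?S. (r \<otimes> f t \<oplus> h t) \<otimes> ?a t)"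
    by (rule lin_action_superset[OF fin]) (use assms(1,4) fc hc in auto)
  also have "\<dots> = (\<Oplus>t\<in>?S. r \<otimes> (f t \<otimes> ?a t) \<oplus> h t \<otimes> ?a t)"
    by (rule finsum_cong') (use assms(1) ac fc hc in \<open>auto simp: l_distr m_assoc\<close>)
  also have "\<dots> = (\<Oplus>t\<in>?S. r \<otimes> (f t \<otimes> ?a t)) \<oplus> (\<Oplus>t\<in>?S. h t \<otimes> ?a t)"
    by (rule finsum_addf) (use assms(1) ac fc hc in auto)
  also have "(\<Oplus>t\<in>?S. r \<otimes> (f t \<otimes> ?a t)) = r \<otimes> (\<Oplus>t\<in>?S. f t \<otimes> ?a t)"
    by (rule finsum_rdistr[symmetric]) (use assms(1) fin ac fc in auto)
  also have "(\<Oplus>t\<in>?S. f t \<otimes> ?a t) = lin_action R f \<phi> w"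
    by (rule lin_action_superset[symmetric, OF fin]) (use assms(4) fc in auto)
  also have "(\<Oplus>t\<in>?S. h t \<otimes> ?a t) = lin_action R h \<phi> w"
    by (rule lin_action_superset[symmetric, OF fin]) (use assms(4) hc in auto)
  finally show ?thesis using e by simp
qed

lemma lin_action_linear_right:
  assumes "f \<in> carrier (free_nonassoc R V)" "r \<in> carrier R"
    and "\<And>w. \<phi> w \<in> carrier R" "\<And>w. \<psi> w \<in> carrier R"
  shows "lin_action R f (\<lambda>w. r \<otimes> \<phi> w \<oplus> \<psi> w) w = r \<otimes> lin_action R f \<phi> w \<oplus> lin_action R f \<psi> w"
  using assms(1)
proof (induction rule: free_nonassoc_induct)
  case zero
  then show ?case using assms(2) by simp
next
  case (step s t f)
  have c: "\<And>w. r \<otimes> \<phi> w \<oplus> \<psi> w \<in> carrier R" using assms by simp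
  note mc = monomial_closed[OF step(2)]
  have "lin_action R (s \<odot>\<^bsub>free_nonassoc R V\<^esub> monomial R t \<oplus>\<^bsub>free_nonassoc R V\<^esub> f) (\<lambda>w. r \<otimes> \<phi> w \<oplus> \<psi> w) w
     = s \<otimes> (r \<otimes> word_action R t \<phi> w \<oplus> word_action R t \<psi> w) \<oplus> (r \<otimes> lin_action R f \<phi> w
         \<oplus> lin_action R f \<psi> w)"
    unfolding lin_action_linear_left[OF step(1) mc step(3), of "\<lambda>w. r \<otimes> \<phi> w \<oplus> \<psi> w", OF c]
      lin_action_monomial[of "\<lambda>w. r \<otimes> \<phi> w \<oplus> \<psi> w", OF c] step(4) word_action_linear[OF assms(2-4)] ..
  also have "\<dots> = r \<otimes> (s \<otimes> word_action R t \<phi> w \<oplus> lin_action R f \<phi> w) \<oplus> (s \<otimes> word_action R t \<psi> w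
      \<oplus> lin_action R f \<psi> w)"
    using step(1) assms(2) word_action_closed[of \<phi> t w, OF assms(3)]
        word_action_closed[of \<psi> t w, OF assms(4)]
      lin_action_closed[OF step(3), of \<phi> w, OF assms(3)]
          lin_action_closed[OF step(3), of \<psi> w, OF assms(4)]
    by algebra
  finally show ?case
    unfolding lin_action_linear_left[OF step(1) mc step(3), of \<phi>, OF assms(3)]
        lin_action_linear_left[OF step(1) mc step(3), of \<psi>, OF assms(4)]
      lin_action_monomial[of \<phi>, OF assms(3)] lin_action_monomial[of \<psi>, OF assms(4)] .
qed

lemma lin_action_zero_right:
  assumes "f \<in> carrier (free_nonassoc R V)" shows "lin_action R f (\<lambda>w. \<zero>) w = \<zero>"
  unfolding lin_action_def using free_nonassoc_carrierD[OF assms] 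
  by (simp add: word_action_zero add.finprod_one)

lemma lin_action_diff_right:
  assumes "f \<in> carrier (free_nonassoc R V)" "\<And>w. \<phi> w \<in> carrier R" "\<And>w. \<psi> w \<in> carrier R"
  shows "lin_action R f (\<lambda>w. \<phi> w \<ominus> \<psi> w) w = lin_action R f \<phi> w \<ominus> lin_action R f \<psi> w"
proof -
  have "(\<lambda>w. \<phi> w \<ominus> \<psi> w) = (\<lambda>w. (\<ominus> \<one>) \<otimes> \<psi> w \<oplus> \<phi> w)"
  proof
    fix w show "\<phi> w \<ominus> \<psi> w = (\<ominus> \<one>) \<otimes> \<psi> w \<oplus> \<phi> w" using assms(2,3)[of w] by algebra
  qed
  then have "lin_action R f (\<lambda>w. \<phi> w \<ominus> \<psi> w) w = (\<ominus> \<one>) \<otimes> lin_action R f \<psi> w \<oplus> lin_action R f \<phi> w"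
    using lin_action_linear_right[OF assms(1) _ assms(3,2), of "\<ominus> \<one>"] by simp
  then show ?thesis using lin_action_closed[OF assms(1), of \<psi> w, OF assms(3)]
      lin_action_closed[OF assms(1), of \<phi> w, OF assms(2)]
    by algebra
qed

lemma monomial_Br:
  "monomial R (Br s t) = monomial R s \<otimes>\<^bsub>free_nonassoc R V\<^esub> monomial R t"
  by (rule ext) (auto simp: monomial_def free_nonassoc_def split: naword.split)

lemma lin_action_prod_monomial:
  assumes "set (word s) \<subseteq> V" "h \<in> carrier (free_nonassoc R V)" "\<And>w. \<phi> w \<in> carrier R"
  shows "lin_action R (monomial R s \<otimes>\<^bsub>free_nonassoc R V\<^esub> h) \<phi> w
    = lin_action R h (word_action R s \<phi>) w \<ominus> word_action R s (lin_action R h \<phi>) w"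
  using assms(2)
proof (induction arbitrary: w rule: free_nonassoc_induct)
  case zero
  interpret A: nonassoc_algebra R "free_nonassoc R V"
    by (rule nonassoc_algebra_free_nonassoc) (rule is_cring)
  have "lin_action R (\<zero>\<^bsub>free_nonassoc R V\<^esub>) \<phi> = (\<lambda>w. \<zero>)" by (rule ext) simp
  then show ?case using monomial_closed[OF assms(1)] by (simp add: word_action_zero minus_eq)
next
  case (step r t h)
  let ?A = "free_nonassoc R V"
  interpret A: nonassoc_algebra R ?A by (rule nonassoc_algebra_free_nonassoc) (rule is_cring)
  note ms = monomial_closed[OF assms(1)] and mt = monomial_closed[OF step(2)]
  have V: "set (word (Br s t)) \<subseteq> V" using assms(1) step(2) by simp
  note wc = word_action_closed[of \<phi>, OF assms(3)]
  note hc = lin_action_closed[OF step(3), of \<phi>, OF assms(3)]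
  note hsc = lin_action_closed[OF step(3), of "word_action R s \<phi>", OF wc]
  have "monomial R s \<otimes>\<^bsub>?A\<^esub> (r \<odot>\<^bsub>?A\<^esub> monomial R t \<oplus>\<^bsub>?A\<^esub> h)
      = r \<odot>\<^bsub>?A\<^esub> monomial R (Br s t) \<oplus>\<^bsub>?A\<^esub> (monomial R s \<otimes>\<^bsub>?A\<^esub> h)"
    using ms mt step by (simp add: A.prod_r_distr A.prod_smult_r monomial_Br[of _ _ V])
  then have "lin_action R (monomial R s \<otimes>\<^bsub>?A\<^esub> (r \<odot>\<^bsub>?A\<^esub> monomial R t \<oplus>\<^bsub>?A\<^esub> h)) \<phi> w
     = r \<otimes> word_action R (Br s t) \<phi> w \<oplus> lin_action R (monomial R s \<otimes>\<^bsub>?A\<^esub> h) \<phi> w"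
    using lin_action_linear_left[OF step(1) monomial_closed[OF V] A.prod_closed[OF ms step(3)], of \<phi>
        w] assms(3)
      lin_action_monomial[of \<phi> "Br s t" w] by simp
  also have "\<dots> = r \<otimes> (word_action R t (word_action R s \<phi>) w
      \<ominus> word_action R s (word_action R t \<phi>) w) \<oplus>
     (lin_action R h (word_action R s \<phi>) w \<ominus> word_action R s (lin_action R h \<phi>) w)"
    using step(4) by simp
  also have "\<dots> = (r \<otimes> word_action R t (word_action R s \<phi>) w \<oplus> lin_action R h (word_action R s \<phi>) w)
     \<ominus> (r \<otimes> word_action R s (word_action R t \<phi>) w \<oplus> word_action R s (lin_action R h \<phi>) w)"
    using step(1) word_action_closed[of "word_action R s \<phi>" t w, OF wc]
        word_action_closed[of "word_action R t \<phi>" s w, OF wc]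
      hsc[of w] word_action_closed[of "lin_action R h \<phi>" s w, OF hc] by algebra
  also have "r \<otimes> word_action R t (word_action R s \<phi>) w \<oplus> lin_action R h (word_action R s \<phi>) w
     = lin_action R (r \<odot>\<^bsub>?A\<^esub> monomial R t \<oplus>\<^bsub>?A\<^esub> h) (word_action R s \<phi>) w"
    using lin_action_linear_left[OF step(1) mt step(3), of "word_action R s \<phi>" w]
        lin_action_monomial[of "word_action R s \<phi>" t w] wc by simp
  also have "r \<otimes> word_action R s (word_action R t \<phi>) w \<oplus> word_action R s (lin_action R h \<phi>) w
     = word_action R s (\<lambda>w. r \<otimes> word_action R t \<phi> w \<oplus> lin_action R h \<phi> w) w"
    using word_action_linear[of r "word_action R t \<phi>" "lin_action R h \<phi>" s w] step(1) wc hc by simp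
  also have "(\<lambda>w. r \<otimes> word_action R t \<phi> w \<oplus> lin_action R h \<phi> w)
      = lin_action R (r \<odot>\<^bsub>?A\<^esub> monomial R t \<oplus>\<^bsub>?A\<^esub> h) \<phi>"
    using lin_action_linear_left[OF step(1) mt step(3), of \<phi>] lin_action_monomial[of \<phi> t] assms(3)
      by (auto simp: fun_eq_iff)
  finally show ?case .
qed

lemma lin_action_prod:
  assumes "f \<in> carrier (free_nonassoc R V)" "h \<in> carrier (free_nonassoc R V)" "\<And>w. \<phi> w \<in> carrier R"
  shows "lin_action R (f \<otimes>\<^bsub>free_nonassoc R V\<^esub> h) \<phi> w
    = lin_action R h (lin_action R f \<phi>) w \<ominus> lin_action R f (lin_action R h \<phi>) w"
  using assms(1)
proof (induction arbitrary: w rule: free_nonassoc_induct)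
  case zero
  interpret A: nonassoc_algebra R "free_nonassoc R V"
    by (rule nonassoc_algebra_free_nonassoc) (rule is_cring)
  have "lin_action R (\<zero>\<^bsub>free_nonassoc R V\<^esub>) \<phi> = (\<lambda>w. \<zero>)" by (rule ext) simp
  then show ?case using assms(2) lin_action_zero_right[OF assms(2)] by (simp add: minus_eq)
next
  case (step r t f)
  let ?A = "free_nonassoc R V"
  interpret A: nonassoc_algebra R ?A by (rule nonassoc_algebra_free_nonassoc) (rule is_cring)
  note mt = monomial_closed[OF step(2)]
  note wc = word_action_closed[of \<phi>, OF assms(3)]
  note hc = lin_action_closed[OF assms(2), of \<phi>, OF assms(3)]
  note fc = lin_action_closed[OF step(3), of \<phi>, OF assms(3)]
  let ?h = "lin_action R h \<phi>" and ?t = "word_action R t \<phi>" and ?f = "lin_action R f \<phi>"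
  have "(r \<odot>\<^bsub>?A\<^esub> monomial R t \<oplus>\<^bsub>?A\<^esub> f) \<otimes>\<^bsub>?A\<^esub> h
      = r \<odot>\<^bsub>?A\<^esub> (monomial R t \<otimes>\<^bsub>?A\<^esub> h) \<oplus>\<^bsub>?A\<^esub> f \<otimes>\<^bsub>?A\<^esub> h"
    using mt step assms(2) by (simp add: A.prod_l_distr A.prod_smult_l)
  then have "lin_action R ((r \<odot>\<^bsub>?A\<^esub> monomial R t \<oplus>\<^bsub>?A\<^esub> f) \<otimes>\<^bsub>?A\<^esub> h) \<phi> w
     = r \<otimes> lin_action R (monomial R t \<otimes>\<^bsub>?A\<^esub> h) \<phi> w \<oplus> lin_action R (f \<otimes>\<^bsub>?A\<^esub> h) \<phi> w"
    using lin_action_linear_left[OF step(1) A.prod_closed[OF mt assms(2)] A.prod_closed[OF step(3)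
        assms(2)], of \<phi> w] assms(3)
    by simp
  also have "\<dots> = r \<otimes> (lin_action R h ?t w \<ominus> word_action R t ?h w) \<oplus> (lin_action R h ?f w
      \<ominus> lin_action R f ?h w)"
    using step(4) lin_action_prod_monomial[OF step(2) assms(2), of \<phi> w] assms(3) by simp
  also have "\<dots> = (r \<otimes> lin_action R h ?t w \<oplus> lin_action R h ?f w) \<ominus> (r \<otimes> word_action R t ?h w
      \<oplus> lin_action R f ?h w)"
    using step(1) lin_action_closed[OF assms(2), of ?t w, OF wc]
        word_action_closed[of ?h t w, OF hc]
      lin_action_closed[OF assms(2), of ?f w, OF fc] lin_action_closed[OF step(3), of ?h w, OF hc]
        by algebra
  also have "r \<otimes> word_action R t ?h w \<oplus> lin_action R f ?h w
      = lin_action R (r \<odot>\<^bsub>?A\<^esub> monomial R t \<oplus>\<^bsub>?A\<^esub> f) ?h w"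
    using lin_action_linear_left[OF step(1) mt step(3), of ?h w] lin_action_monomial[of ?h t w] hc
      by simp
  also have "r \<otimes> lin_action R h ?t w \<oplus> lin_action R h ?f w = lin_action R h (\<lambda>w. r \<otimes> ?t w \<oplus> ?f w) w"
    using lin_action_linear_right[OF assms(2) step(1), of ?t ?f w] wc fc by simp
  also have "(\<lambda>w. r \<otimes> ?t w \<oplus> ?f w) = lin_action R (r \<odot>\<^bsub>?A\<^esub> monomial R t \<oplus>\<^bsub>?A\<^esub> f) \<phi>"
    using lin_action_linear_left[OF step(1) mt step(3), of \<phi>] lin_action_monomial[of \<phi> t] assms(3)
      by (auto simp: fun_eq_iff)
  finally show ?case .
qed

lemma lin_action_trace_invariant:
  assumes "f \<in> carrier (free_nonassoc R V)" "trace_invariant R E \<phi>"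
  shows "trace_invariant R E (lin_action R f \<phi>)"
proof -
  have "lin_action R f \<phi> u = lin_action R f \<phi> v" if "trace_eq E u v" for u v
    unfolding lin_action_def using word_action_trace_invariant[OF assms(2)] that
    by (simp add: trace_invariant_def)
  then show ?thesis using lin_action_closed[OF assms(1)] assms(2) by (simp add: trace_invariant_def)
qed

text \<open>
  Functions that are constant on traces stand for the dual of the partially commutative associative
  algebra, so these elements are those that vanish in it.
\<close>

definition annihilator :: "'x set \<Rightarrow> 'x set set \<Rightarrow> ('x naword \<Rightarrow> 'a) set" where
  "annihilator V E = {f \<in> carrier (free_nonassoc R V). \<forall>\<phi>. trace_invariant R E \<phi> \<longrightarrow>
      (\<forall>w. lin_action R f \<phi> w = \<zero>)}"

lemma annihilator_ideal: "algebra_ideal R (free_nonassoc R V) (annihilator V E)"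
proof -
  let ?A = "free_nonassoc R V" and ?J = "annihilator V E"
  interpret A: nonassoc_algebra R ?A by (rule nonassoc_algebra_free_nonassoc) (rule is_cring)
  have lin: "r \<odot>\<^bsub>?A\<^esub> f \<oplus>\<^bsub>?A\<^esub> h \<in> ?J" if "r \<in> carrier R" "f \<in> ?J" "h \<in> ?J" for r f h
    using that lin_action_linear_left[of r f V h]
      by (auto simp: annihilator_def trace_invariant_def)
  have z: "\<zero>\<^bsub>?A\<^esub> \<in> ?J" by (simp add: annihilator_def)
  have sub: "?J \<subseteq> carrier ?A" by (auto simp: annihilator_def)
  have sm: "r \<odot>\<^bsub>?A\<^esub> f \<in> ?J" if "r \<in> carrier R" "f \<in> ?J" for r f
    using lin[OF that z] that sub by auto
  have ad: "f \<oplus>\<^bsub>?A\<^esub> h \<in> ?J" if "f \<in> ?J" "h \<in> ?J" for f h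
    using lin[OF one_closed that] that sub by auto
  have "submodule ?J R ?A"
  proof (rule A.submoduleI[OF sub z])
    fix f assume f: "f \<in> ?J"
    then have "\<ominus>\<^bsub>?A\<^esub> f = (\<ominus> \<one>) \<odot>\<^bsub>?A\<^esub> f" using A.smult_l_minus[of \<one> f] sub by auto
    then show "\<ominus>\<^bsub>?A\<^esub> f \<in> ?J" using sm[OF _ f, of "\<ominus> \<one>"] by simp
  qed (use sm ad in auto)
  moreover have "a \<otimes>\<^bsub>?A\<^esub> f \<in> ?J \<and> f \<otimes>\<^bsub>?A\<^esub> a \<in> ?J" if a: "a \<in> carrier ?A" and f: "f \<in> ?J" for a f
  proof -
    have fc: "f \<in> carrier ?A" using f sub by auto
    have "lin_action R (a \<otimes>\<^bsub>?A\<^esub> f) \<phi> w = \<zero> \<and> lin_action R (f \<otimes>\<^bsub>?A\<^esub> a) \<phi> w = \<zero>"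
        if inv: "trace_invariant R E \<phi>" for \<phi> w
    proof -
      have z: "lin_action R f \<psi> = (\<lambda>w. \<zero>)" if "trace_invariant R E \<psi>" for \<psi>
        using f that by (auto simp: annihilator_def)
      have c: "\<And>w. \<phi> w \<in> carrier R" using inv by (simp add: trace_invariant_def)
      show ?thesis using lin_action_prod[OF a fc c] lin_action_prod[OF fc a c] z[OF inv]
          z[OF lin_action_trace_invariant[OF a inv]] lin_action_zero_right[OF a]
        by (simp add: minus_eq)
    qed
    then show ?thesis using A.prod_closed[OF a fc] A.prod_closed[OF fc a]
      by (auto simp: annihilator_def)
  qed
  ultimately show ?thesis by (simp add: algebra_ideal_def)
qed

text \<open>
  The product acts as a commutator of linear operators, and commutators satisfy the Lie identities.
\<close>

lemma lie_identities_annihilator: "lie_identities (free_nonassoc R V) \<subseteq> annihilator V E"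
proof -
  let ?A = "free_nonassoc R V" and ?J = "annihilator V E"
  interpret A: nonassoc_algebra R ?A by (rule nonassoc_algebra_free_nonassoc) (rule is_cring)
  have "x \<otimes>\<^bsub>?A\<^esub> x \<in> ?J" if x: "x \<in> carrier ?A" for x
  proof -
    have "lin_action R (x \<otimes>\<^bsub>?A\<^esub> x) \<phi> w = \<zero>" if "trace_invariant R E \<phi>" for \<phi> w
    proof -
      have c: "\<And>w. \<phi> w \<in> carrier R" using that by (simp add: trace_invariant_def)
      have "lin_action R x (lin_action R x \<phi>) w \<in> carrier R" using lin_action_closed x c by blast
      then show ?thesis using lin_action_prod[OF x x c] by (simp add: minus_eq r_neg)
    qed
    then show ?thesis using A.prod_closed[OF x x] by (auto simp: annihilator_def)
  qed
  moreover have "jacobian ?A x y z \<in> ?J"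
      if x: "x \<in> carrier ?A" and y: "y \<in> carrier ?A" and z: "z \<in> carrier ?A" for x y z
  proof -
    have "lin_action R (jacobian ?A x y z) \<phi> w = \<zero>" if "trace_invariant R E \<phi>" for \<phi> w
    proof -
      have c: "\<And>w. \<phi> w \<in> carrier R" using that by (simp add: trace_invariant_def)
      define X Y Z where "X = lin_action R x" and "Y = lin_action R y" and "Z = lin_action R z"
      note cl = lin_action_closed[OF x, folded X_def] lin_action_closed[OF y, folded Y_def]
          lin_action_closed[OF z, folded Z_def]
      have add: "lin_action R (f \<oplus>\<^bsub>?A\<^esub> h) \<phi> w = lin_action R f \<phi> w \<oplus> lin_action R h \<phi> w"
        if "f \<in> carrier ?A" "h \<in> carrier ?A" for f h
        using lin_action_linear_left[OF one_closed that, of \<phi> w]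
            lin_action_closed[OF that(1), of \<phi> w] c that by simp
      have triple: "lin_action R ((f \<otimes>\<^bsub>?A\<^esub> h) \<otimes>\<^bsub>?A\<^esub> k) \<phi> w =
          (F (H' (F' \<phi>)) w \<ominus> F (F' (H' \<phi>)) w) \<ominus> (H' (F' (F \<phi>)) w \<ominus> F' (H' (F \<phi>)) w)"
        if f: "f \<in> carrier ?A" and h: "h \<in> carrier ?A" and k: "k \<in> carrier ?A"
          and d: "F = lin_action R k" "H' = lin_action R h" "F' = lin_action R f" for f h k F H' F'
      proof -
        note cf = lin_action_closed[OF f] and ch = lin_action_closed[OF h] and ck
            = lin_action_closed[OF k]
        have "lin_action R (f \<otimes>\<^bsub>?A\<^esub> h) \<phi> = (\<lambda>w. H' (F' \<phi>) w \<ominus> F' (H' \<phi>) w)"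
          using lin_action_prod[OF f h c] d by auto
        moreover have "\<And>w. H' (F' \<phi>) w \<in> carrier R" "\<And>w. F' (H' \<phi>) w \<in> carrier R"
            "\<And>w. F \<phi> w \<in> carrier R"
          using c cf ch ck d by auto
        ultimately show ?thesis
          using lin_action_prod[OF A.prod_closed[OF f h] k c]
              lin_action_diff_right[OF k, of "H' (F' \<phi>)" "F' (H' \<phi>)" w]
            lin_action_prod[OF f h, of "F \<phi>" w] d by simp
      qed
      have "lin_action R (jacobian ?A x y z) \<phi> w =
         ((Z (Y (X \<phi>)) w \<ominus> Z (X (Y \<phi>)) w) \<ominus> (Y (X (Z \<phi>)) w \<ominus> X (Y (Z \<phi>)) w)) \<oplus>
         (((X (Z (Y \<phi>)) w \<ominus> X (Y (Z \<phi>)) w) \<ominus> (Z (Y (X \<phi>)) w \<ominus> Y (Z (X \<phi>)) w)) \<oplus>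
          ((Y (X (Z \<phi>)) w \<ominus> Y (Z (X \<phi>)) w) \<ominus> (X (Z (Y \<phi>)) w \<ominus> Z (X (Y \<phi>)) w)))"
        unfolding jacobian_def using x y z
        by (simp add: add A.prod_closed triple[OF x y z Z_def Y_def X_def]
            triple[OF y z x X_def Z_def Y_def]
            triple[OF z x y Y_def X_def Z_def])
      moreover have "Z (Y (X \<phi>)) w \<in> carrier R" "Z (X (Y \<phi>)) w \<in> carrier R"
          "Y (X (Z \<phi>)) w \<in> carrier R"
        "X (Y (Z \<phi>)) w \<in> carrier R" "X (Z (Y \<phi>)) w \<in> carrier R" "Y (Z (X \<phi>)) w \<in> carrier R"
        using cl c by auto
      ultimately show ?thesis by (simp only:) algebra
    qed
    then show ?thesis using x y z by (auto simp: annihilator_def jacobian_def A.prod_closed)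
  qed
  ultimately show ?thesis unfolding lie_identities_def by blast
qed

lemma commuting_letters_annihilator:
  assumes "{x, y} \<in> E" "x \<in> V" "y \<in> V"
  shows "monomial R (Br (Letter x) (Letter y)) \<in> annihilator V E"
proof -
  have "lin_action R (monomial R (Br (Letter x) (Letter y))) \<phi> w = \<zero>"
      if "trace_invariant R E \<phi>" for \<phi> w
  proof -
    have "\<phi> (x # y # w) = \<phi> (y # x # w)" "\<And>w. \<phi> w \<in> carrier R"
      using that trace_eq_commute[OF assms(1)] by (auto simp: trace_invariant_def)
    then show ?thesis by (simp add: lin_action_monomial minus_eq r_neg)
  qed
  then show ?thesis using monomial_closed[of "Br (Letter x) (Letter y)" V] assms
    by (auto simp: annihilator_def)
qed

end

section \<open>The presentation of the partially commutative Lie algebra\<close>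

context nonassoc_algebra
begin

lemma coset_eq_imp_diff:
  assumes "algebra_ideal R A I" "x \<in> carrier A" "y \<in> carrier A" "I +>\<^bsub>A\<^esub> x = I +>\<^bsub>A\<^esub> y"
  shows "x \<ominus>\<^bsub>A\<^esub> y \<in> I"
proof -
  note Q = quot_algebra[OF assms(1)]
  have "I +>\<^bsub>A\<^esub> (x \<oplus>\<^bsub>A\<^esub> \<ominus>\<^bsub>A\<^esub> y) = I +>\<^bsub>A\<^esub> (y \<oplus>\<^bsub>A\<^esub> \<ominus>\<^bsub>A\<^esub> y)"
    using Q(3)[of x "\<ominus>\<^bsub>A\<^esub> y"] Q(3)[of y "\<ominus>\<^bsub>A\<^esub> y"] assms(2-4) by simp
  moreover have "\<zero>\<^bsub>A\<^esub> \<in> I"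
    using assms(1) subgroup.one_closed[of I "add_monoid A"]
      by (auto simp: algebra_ideal_def dest: submodule.axioms(1))
  then have "I +>\<^bsub>A\<^esub> (y \<oplus>\<^bsub>A\<^esub> \<ominus>\<^bsub>A\<^esub> y) = I" using Q(7)[of "\<zero>\<^bsub>A\<^esub>"] assms(3) by (simp add: M.r_neg)
  ultimately show ?thesis using Q(7)[of "x \<oplus>\<^bsub>A\<^esub> \<ominus>\<^bsub>A\<^esub> y"] assms(2,3) by (simp add: a_minus_def)
qed

text \<open>
  Serves to compare ideals across the two successive quotients of the presentation.
\<close>

lemma algebra_ideal_image_quot:
  assumes I: "algebra_ideal R A I" and J: "algebra_ideal R A J"
  shows "algebra_ideal R (quot_algebra A I) ((\<lambda>x. I +>\<^bsub>A\<^esub> x) ` J)"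
proof -
  note Q = quot_algebra[OF I]
  interpret Q: nonassoc_algebra R "quot_algebra A I" by (rule Q(1))
  have sJ: "submodule J R A" and id: "\<And>a i. a \<in> carrier A \<Longrightarrow> i \<in> J \<Longrightarrow> a \<otimes>\<^bsub>A\<^esub> i \<in> J \<and> i \<otimes>\<^bsub>A\<^esub> a \<in> J"
    using J by (auto simp: algebra_ideal_def)
  note smE = submoduleE[OF sJ]
  have Jc: "\<And>x. x \<in> J \<Longrightarrow> x \<in> carrier A" using smE(1) by blast
  have "submodule ((\<lambda>x. I +>\<^bsub>A\<^esub> x) ` J) R (quot_algebra A I)"
  proof (rule Q.submoduleI)
    show "(\<lambda>x. I +>\<^bsub>A\<^esub> x) ` J \<subseteq> carrier (quot_algebra A I)" using Q(2) Jc by auto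
    have zJ: "\<zero>\<^bsub>A\<^esub> \<in> J" and zI: "\<zero>\<^bsub>A\<^esub> \<in> I"
      using I J subgroup.one_closed[of _ "add_monoid A"]
        by (auto simp: algebra_ideal_def dest!: submodule.axioms(1))
    have "\<zero>\<^bsub>quot_algebra A I\<^esub> = I +>\<^bsub>A\<^esub> \<zero>\<^bsub>A\<^esub>" using Q(6) Q(7)[of "\<zero>\<^bsub>A\<^esub>"] zI by simp
    then show "\<zero>\<^bsub>quot_algebra A I\<^esub> \<in> (\<lambda>x. I +>\<^bsub>A\<^esub> x) ` J" using zJ by blast
    fix c assume "c \<in> (\<lambda>x. I +>\<^bsub>A\<^esub> x) ` J"
    then obtain x where x: "x \<in> J" "c = I +>\<^bsub>A\<^esub> x" by blast
    have cc: "c \<in> carrier (quot_algebra A I)" using x Q(2) Jc by auto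
    have "\<ominus>\<^bsub>quot_algebra A I\<^esub> c = (\<ominus> \<one>) \<odot>\<^bsub>quot_algebra A I\<^esub> c" using Q.smult_l_minus[of \<one> c] cc by simp
    then have "\<ominus>\<^bsub>quot_algebra A I\<^esub> c = I +>\<^bsub>A\<^esub> ((\<ominus> \<one>) \<odot>\<^bsub>A\<^esub> x)" using x Q(5) Jc by simp
    then show "\<ominus>\<^bsub>quot_algebra A I\<^esub> c \<in> (\<lambda>x. I +>\<^bsub>A\<^esub> x) ` J" using smE(4)[of "\<ominus> \<one>" x] x by auto
  next
    fix c d assume "c \<in> (\<lambda>x. I +>\<^bsub>A\<^esub> x) ` J" "d \<in> (\<lambda>x. I +>\<^bsub>A\<^esub> x) ` J"
    then show "c \<oplus>\<^bsub>quot_algebra A I\<^esub> d \<in> (\<lambda>x. I +>\<^bsub>A\<^esub> x) ` J" using Q(3) Jc smE(5) by auto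
  next
    fix r c assume "r \<in> carrier R" "c \<in> (\<lambda>x. I +>\<^bsub>A\<^esub> x) ` J"
    then show "r \<odot>\<^bsub>quot_algebra A I\<^esub> c \<in> (\<lambda>x. I +>\<^bsub>A\<^esub> x) ` J" using Q(5) Jc smE(4) by auto
  qed
  then show ?thesis using id Jc Q(2,4) by (auto simp: algebra_ideal_def)
qed

end

locale pc_lie_presentation = cring R for R :: "('r, 'm) ring_scheme" (structure) +
  fixes V :: "'x::linorder set" and E :: "'x set set"
  assumes finite_V: "finite V" and edges: "E \<subseteq> {e. e \<subseteq> V \<and> card e = 2}"
begin

abbreviation "A \<equiv> free_nonassoc R V"
abbreviation "I \<equiv> free_lie_ideal R V"
abbreviation "F \<equiv> free_lie R V"
abbreviation "K \<equiv> pc_lie_ideal R V E"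
abbreviation "P \<equiv> pc_lie R V E"

text \<open>
  The composite of the two quotient maps, from the free non-associative algebra onto the partially
  commutative Lie algebra.
\<close>

definition proj :: "('x naword \<Rightarrow> 'r) \<Rightarrow> ('x naword \<Rightarrow> 'r) set set" where
  "proj f = K +>\<^bsub>F\<^esub> (I +>\<^bsub>A\<^esub> f)"

lemma edge: "{x, y} \<in> E \<Longrightarrow> x \<in> V \<and> y \<in> V \<and> x \<noteq> y"
  using edges by (auto simp: card_insert_if split: if_splits)

sublocale A: nonassoc_algebra R A by (rule nonassoc_algebra_free_nonassoc) (rule is_cring)
sublocale F: lie_algebra R F by (rule lie_algebra_free_lie) (rule is_cring)
sublocale P: lie_algebra R P by (rule lie_algebra_pc_lie[OF is_cring]) (use edge in blast)

lemma generator_closed: "x \<in> V \<Longrightarrow> free_lie_gen R V x \<in> carrier F"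
  by (rule free_lie_gen_closed[OF is_cring])

lemma monomial_Letter: "monomial R (Letter x) = nonassoc_gen R x"
  by (simp add: monomial_def nonassoc_gen_def)

lemma lie_ideal: "algebra_ideal R A I" "lie_identities A \<subseteq> I"
proof -
  have "lie_identities A \<subseteq> carrier A" by (auto simp: lie_identities_def jacobian_def A.prod_closed)
  then show "algebra_ideal R A I" "lie_identities A \<subseteq> I" using A.algebra_ideal_ideal_gen
    unfolding free_lie_ideal_def by blast+
qed

lemma pc_ideal: "algebra_ideal R F K"
  "{x, y} \<in> E \<Longrightarrow> free_lie_gen R V x \<otimes>\<^bsub>F\<^esub> free_lie_gen R V y \<in> K"
proof -
  have "{free_lie_gen R V x \<otimes>\<^bsub>F\<^esub> free_lie_gen R V y | x y. {x, y} \<in> E} \<subseteq> carrier F"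
    using edge generator_closed by (auto intro!: F.prod_closed)
  note * = F.algebra_ideal_ideal_gen[OF this]
  show "algebra_ideal R F K" using * unfolding pc_lie_ideal_def by blast
  show "{x, y} \<in> E \<Longrightarrow> free_lie_gen R V x \<otimes>\<^bsub>F\<^esub> free_lie_gen R V y \<in> K" using *
    unfolding pc_lie_ideal_def by blast
qed

lemmas FQ = A.quot_algebra[OF lie_ideal(1), folded free_lie_def]
lemmas PQ = F.quot_algebra[OF pc_ideal(1), folded pc_lie_def]

lemma proj_closed: "f \<in> carrier A \<Longrightarrow> proj f \<in> carrier P"
  unfolding proj_def using PQ(2) FQ(2) by blast

lemma proj_surj: "m \<in> carrier P \<Longrightarrow> \<exists>f\<in>carrier A. m = proj f"
  unfolding proj_def using PQ(2) FQ(2) by auto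

lemma proj_add: "f \<in> carrier A \<Longrightarrow> h \<in> carrier A \<Longrightarrow> proj (f \<oplus>\<^bsub>A\<^esub> h) = proj f \<oplus>\<^bsub>P\<^esub> proj h"
  unfolding proj_def using PQ(3) FQ(2,3) by auto

lemma proj_smult: "r \<in> carrier R \<Longrightarrow> f \<in> carrier A \<Longrightarrow> proj (r \<odot>\<^bsub>A\<^esub> f) = r \<odot>\<^bsub>P\<^esub> proj f"
  unfolding proj_def using PQ(5) FQ(2,5) by auto

lemma proj_prod: "f \<in> carrier A \<Longrightarrow> h \<in> carrier A \<Longrightarrow> proj (f \<otimes>\<^bsub>A\<^esub> h) = proj f \<otimes>\<^bsub>P\<^esub> proj h"
  unfolding proj_def using PQ(4) FQ(2,4) by auto

lemma proj_zero: "proj \<zero>\<^bsub>A\<^esub> = \<zero>\<^bsub>P\<^esub>"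
  using proj_add[of "\<zero>\<^bsub>A\<^esub>" "\<zero>\<^bsub>A\<^esub>"] proj_closed[of "\<zero>\<^bsub>A\<^esub>"] P.M.add.r_cancel_one[of "proj \<zero>\<^bsub>A\<^esub>" "proj \<zero>\<^bsub>A\<^esub>"]
    by simp

lemma proj_monomial: "set (word t) \<subseteq> V \<Longrightarrow> proj (monomial R t) = lie_eval P (pc_lie_gen R V E) t"
proof (induction t)
  case (Letter x)
  show ?case by (simp add: monomial_Letter proj_def pc_lie_gen_def free_lie_gen_def)
next
  case (Br s t)
  then show ?case using proj_prod[of "monomial R s" "monomial R t"] monomial_closed[of s V]
      monomial_closed[of t V]
    by (simp add: monomial_Br[of _ _ V])
qed

text \<open>
  The image of the annihilator in the free Lie algebra is an ideal containing the defining relations.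
  An element with image in it differs from the annihilator by an element of the ideal of Lie
  identities, which the annihilator contains as well.
\<close>

lemma proj_eq_zero_annihilator:
  assumes f: "f \<in> carrier A" and z: "proj f = \<zero>\<^bsub>P\<^esub>"
  shows "f \<in> annihilator V E"
proof -
  let ?J = "annihilator V E"
  have IJ: "I \<subseteq> ?J" unfolding free_lie_ideal_def ideal_gen_def
    using annihilator_ideal lie_identities_annihilator by blast
  have "algebra_ideal R F ((\<lambda>x. I +>\<^bsub>A\<^esub> x) ` ?J)"
    unfolding free_lie_def by (rule A.algebra_ideal_image_quot[OF lie_ideal(1) annihilator_ideal])
  moreover have "free_lie_gen R V x \<otimes>\<^bsub>F\<^esub> free_lie_gen R V y \<in> (\<lambda>x. I +>\<^bsub>A\<^esub> x) ` ?J"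
      if e: "{x, y} \<in> E" for x y
  proof -
    have xy: "x \<in> V" "y \<in> V" using edge[OF e] by auto
    have "free_lie_gen R V x \<otimes>\<^bsub>F\<^esub> free_lie_gen R V y = I +>\<^bsub>A\<^esub> monomial R (Br (Letter x) (Letter y))"
      unfolding free_lie_gen_def monomial_Br[of _ _ V] monomial_Letter
      by (rule FQ(4)) (use xy in \<open>auto intro: nonassoc_gen_closed[OF is_cring]\<close>)
    then show ?thesis using commuting_letters_annihilator[OF e xy] by blast
  qed
  ultimately have "K \<subseteq> (\<lambda>x. I +>\<^bsub>A\<^esub> x) ` ?J" unfolding pc_lie_ideal_def ideal_gen_def by blast
  moreover have "I +>\<^bsub>A\<^esub> f \<in> K" using z f FQ(2) PQ(6,7) by (auto simp: proj_def)
  ultimately obtain h where h: "h \<in> ?J" "I +>\<^bsub>A\<^esub> f = I +>\<^bsub>A\<^esub> h" by blast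
  have hc: "h \<in> carrier A" using h(1) by (simp add: annihilator_def)
  have d: "f \<ominus>\<^bsub>A\<^esub> h \<in> ?J" using A.coset_eq_imp_diff[OF lie_ideal(1) f hc h(2)] IJ by blast
  have "submodule ?J R A" using annihilator_ideal[of V E] by (simp add: algebra_ideal_def)
  from A.submoduleE(5)[OF this d h(1)]
  have "(f \<ominus>\<^bsub>A\<^esub> h) \<oplus>\<^bsub>A\<^esub> h \<in> ?J" .
  then show ?thesis using f hc by (simp add: a_minus_def A.M.a_assoc A.M.l_neg)
qed

sublocale P: commuting_generators R P V E "pc_lie_gen R V E"
proof unfold_locales
  show "finite V" by (rule finite_V)
  show "{x, x} \<notin> E" for x using edge by blast
  show "pc_lie_gen R V E x \<in> carrier P" if "x \<in> V" for x
    using PQ(2) generator_closed[OF that] by (auto simp: pc_lie_gen_def)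
  show "pc_lie_gen R V E x \<otimes>\<^bsub>P\<^esub> pc_lie_gen R V E y = \<zero>\<^bsub>P\<^esub>" if e: "{x, y} \<in> E" for x y
    using edge[OF e] PQ(4,6,7) pc_ideal(2)[OF e] generator_closed
    by (simp add: pc_lie_gen_def F.prod_closed)
qed

lemma normal_words_eq: "P.normal_words = pc_basis_words V E"
  using pc_basis_words_iff[OF P.loopfree] by (auto simp: P.normal_words_def)

lemma proj_finsum:
  assumes "finite S" "S \<subseteq> P.normal_words" "c \<in> S \<rightarrow> carrier R"
  shows "(\<lambda>t. if t \<in> S then c t else \<zero>) \<in> carrier A \<and>
    proj (\<lambda>t. if t \<in> S then c t else \<zero>) = (\<Oplus>\<^bsub>P\<^esub>t\<in>S. c t \<odot>\<^bsub>P\<^esub> P.ev t)"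
  using assms
proof (induction S rule: finite_induct)
  case empty
  have "(\<lambda>t. if t \<in> {} then c t else \<zero>) = \<zero>\<^bsub>A\<^esub>" by (auto simp: free_nonassoc_def)
  then show ?case using proj_zero by simp
next
  case (insert s S)
  let ?f = "\<lambda>t. if t \<in> S then c t else \<zero>" and ?h = "\<lambda>t. if t \<in> insert s S then c t else \<zero>"
  have f: "?f \<in> carrier A" "proj ?f = (\<Oplus>\<^bsub>P\<^esub>t\<in>S. c t \<odot>\<^bsub>P\<^esub> P.ev t)" using insert by auto
  have s: "c s \<in> carrier R" "set (word s) \<subseteq> V" using insert.prems by (auto simp: P.normal_words_def)
  have m: "monomial R s \<in> carrier A" by (rule monomial_closed[OF s(2)])
  have h: "?h = c s \<odot>\<^bsub>A\<^esub> monomial R s \<oplus>\<^bsub>A\<^esub> ?f"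
    using insert.hyps(2) s(1) funcset_mem[OF insert.prems(2)]
    by (auto simp: free_nonassoc_def monomial_def fun_eq_iff)
  have "proj ?h = c s \<odot>\<^bsub>P\<^esub> P.ev s \<oplus>\<^bsub>P\<^esub> proj ?f"
    unfolding h using m f s by (simp add: proj_add proj_smult proj_monomial)
  moreover have "(\<Oplus>\<^bsub>P\<^esub>t\<in>insert s S. c t \<odot>\<^bsub>P\<^esub> P.ev t) = c s \<odot>\<^bsub>P\<^esub> P.ev s \<oplus>\<^bsub>P\<^esub> (\<Oplus>\<^bsub>P\<^esub>t\<in>S. c t \<odot>\<^bsub>P\<^esub> P.ev t)"
    by (rule P.M.finsum_insert) (use insert P.ev_closed in \<open>auto simp: Pi_iff\<close>)
  moreover have "?h \<in> carrier A" unfolding h using m f(1) s(1) by simp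
  ultimately show ?case using f(2) by simp
qed

text \<open>
  The test function is the indicator of the trace of the largest basis word \<open>u\<close> of the relation.
\<close>

lemma basis_words_independent:
  assumes S: "finite S" "S \<subseteq> P.normal_words" "c \<in> S \<rightarrow> carrier R"
    and zero: "(\<Oplus>\<^bsub>P\<^esub>t\<in>S. c t \<odot>\<^bsub>P\<^esub> P.ev t) = \<zero>\<^bsub>P\<^esub>"
  shows "\<forall>t\<in>S. c t = \<zero>"
proof (rule ccontr)
  assume ne: "\<not> (\<forall>t\<in>S. c t = \<zero>)"
  define T where "T = {t \<in> S. c t \<noteq> \<zero>}"
  have T: "finite T" "T \<noteq> {}" using S(1) ne by (auto simp: T_def)
  have "transp_on T (\<lambda>s t. word_less (word s) (word t))"
      "asymp_on T (\<lambda>s t. word_less (word s) (word t))"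
    by (auto intro!: transp_onI asymp_onI dest: word_less_asym elim: word_less_trans)
  then have "\<exists>u\<in>T. \<forall>t\<in>T. t \<noteq> u \<longrightarrow> \<not> word_less (word u) (word t)"
    using Finite_Set.bex_max_element[OF T(1) _ _ T(2)] by blast
  then obtain u where u: "u \<in> T" "\<And>t. t \<in> T \<Longrightarrow> word_le (word t) (word u)"
    by (metis not_word_less word_le_refl)
  define f where "f = (\<lambda>t. if t \<in> S then c t else \<zero>)"
  have f: "f \<in> carrier A" "f \<in> annihilator V E"
    using proj_finsum[OF S] zero proj_eq_zero_annihilator by (auto simp: f_def)
  have Tf: "{t. f t \<noteq> \<zero>} = T" by (auto simp: f_def T_def)
  define \<phi> where "\<phi> = (\<lambda>w. if trace_eq E (word u) w then \<one> else \<zero>)"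
  have "trace_eq E (word u) v \<longleftrightarrow> trace_eq E (word u) w" if "trace_eq E v w" for v w
    using trace_eq_trans[OF _ that, of "word u"]
        trace_eq_trans[OF _ trace_eq_sym[OF that], of "word u"] by blast
  then have inv: "trace_invariant R E \<phi>" by (auto simp: trace_invariant_def \<phi>_def)
  have \<phi>c: "\<And>w. \<phi> w \<in> carrier R" using inv by (simp add: trace_invariant_def)
  have nu: "nonassoc_LS u" "\<not> commuting_factor E (word u)" using u(1) S(2)
    by (auto simp: T_def P.normal_words_def)
  have low: "word_le (word u) v" if "\<phi> v \<noteq> \<zero>" for v
    using that trace_eq_less_commuting_factor[OF P.loopfree, of "word u" v] nu(2) not_word_less
    by (auto simp: \<phi>_def split: if_splits)
  have act: "word_action R t \<phi> [] = (if t = u then \<one> else \<zero>)" if t: "t \<in> T" for t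
  proof -
    have LS: "nonassoc_LS t" using t S(2) by (auto simp: T_def P.normal_words_def)
    have zero: "\<phi> v = \<zero>" if "word_le v (word t)" "v \<noteq> word u" for v
    proof (rule ccontr)
      assume "\<phi> v \<noteq> \<zero>"
      then have "word_le (word u) v" using low by blast
      moreover have "word_le v (word u)" using that(1) u(2)[OF t] word_le_trans by blast
      ultimately show False using that(2) word_less_asym by (auto simp: word_le_def)
    qed
    have "v \<noteq> word u" if "word_less v (word t)" for v
      using that u(2)[OF t] word_less_le_trans by (metis word_less_irrefl)
    then have "word_action R t \<phi> [] = \<phi> (word t @ [])"
      by (intro word_action_leading[OF LS \<phi>c]) (use zero in \<open>auto simp: word_le_def\<close>)
    moreover have "\<phi> (word t) = \<zero>" if "t \<noteq> u"
      using zero[of "word t"] that nonassoc_LS_unique[OF LS nu(1)] by auto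
    ultimately show ?thesis by (auto simp: \<phi>_def)
  qed
  have "lin_action R f \<phi> [] = (\<Oplus>t\<in>T. f t \<otimes> word_action R t \<phi> [])" by (simp add: lin_action_def Tf)
  also have "\<dots> = (\<Oplus>t\<in>T. if u = t then f u else \<zero>)"
    by (rule finsum_cong') (use act free_nonassoc_carrierD(1)[OF f(1)] in auto)
  also have "\<dots> = f u"
    by (rule add.finprod_singleton[OF u(1) T(1)]) (use free_nonassoc_carrierD(1)[OF f(1)] in auto)
  finally have "f u = \<zero>" using f(2) inv by (simp add: annihilator_def)
  then show False using u(1) Tf by blast
qed

lemma basis_words_spanning:
  assumes "m \<in> carrier P" shows "m \<in> lin_span R P (P.ev ` P.normal_words)"
proof -
  obtain f where f: "f \<in> carrier A" "m = proj f" using proj_surj[OF assms] by blast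
  have cl: "P.ev ` P.normal_words \<subseteq> carrier P" using P.ev_closed by auto
  from f(1) have "proj f \<in> lin_span R P (P.ev ` P.normal_words)"
  proof (induction rule: free_nonassoc_induct)
    case zero then show ?case by (simp add: proj_zero lin_span.zero)
  next
    case (step r t f)
    then show ?case using monomial_closed[OF step(2)] P.ev_in_lin_span[OF step(2)]
      by (simp add: proj_add proj_smult proj_monomial P.lin_span_add[OF cl] P.lin_span_smult[OF cl])
  qed
  then show ?thesis using f(2) by simp
qed

end

theorem theorem2p12:
  fixes R :: "('r, 'm) ring_scheme" and V :: "'x::linorder set" and E :: "'x set set"
  assumes "cring R"
    and "finite V"
    and "E \<subseteq> {e. e \<subseteq> V \<and> card e = 2}"
  shows "lin_basis R (pc_lie R V E) (pc_basis_words V E)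
           (lie_eval (pc_lie R V E) (pc_lie_gen R V E))"
proof -
  interpret pc_lie_presentation R V E
    by (intro pc_lie_presentation.intro pc_lie_presentation_axioms.intro assms)
  have closed: "P.ev \<in> P.normal_words \<rightarrow> carrier P" using P.ev_closed by blast
  show ?thesis unfolding lin_basis_def normal_words_eq[symmetric]
  proof (intro conjI allI impI ballI closed)
    fix S c t assume
        "finite S \<and> S \<subseteq> P.normal_words \<and> c \<in> S \<rightarrow> carrier R \<and> (\<Oplus>\<^bsub>P\<^esub>i\<in>S. c i \<odot>\<^bsub>P\<^esub> P.ev i) = \<zero>\<^bsub>P\<^esub>" "t \<in> S"
    then show "c t = \<zero>\<^bsub>R\<^esub>" using basis_words_independent by blast
  next
    fix m assume "m \<in> carrier P"
    then show "\<exists>S c. finite S \<and> S \<subseteq> P.normal_words \<and> c \<in> S \<rightarrow> carrier R \<and> m = (\<Oplus>\<^bsub>P\<^esub>i\<in>S. c i \<odot>\<^bsub>P\<^esub> P.ev i)"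
      using P.lin_span_image_finsum[OF closed] basis_words_spanning by blast
  qed
qed

end
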